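(* Let $w$ be a $U$-random function with $U\in L_{r,i}(\mathcal A_{r,C}^n,\mathcal A_{r,C}^n)$, and let $\{S(t):t\in T\}$ be an $L_{r,i}(\mathcal A_{r,C}^n,\mathcal A_{r,C}^h)$-valued predictable random function satisfying $$E\Big[\int_a^t\mathrm{Tr}\big(\{S(\tau)U^{1/2}\}\{(U^{1/2})^*S^*(\tau)\}\big)\,d\tau\Big]<\infty$$ for each $0\le a<t$ in $T$. Then there exists a sequence $\{S_\kappa(t):\kappa\in\mathbb N\}$, $t\in T$, of elementary random functions such that $$\lim_{\kappa\to\infty}E\Big[\int_a^t\mathrm{Tr}\big(\{(S(\tau)-S_\kappa(\tau))U^{1/2}\}\{(U^{1/2})^*(S^*(\tau)-S_\kappa^*(\tau))\}\big)\,d\tau\Big]=0$$ for each $0\le a<t$ in $T$.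
   Context: Algebra. $r$ is an integer, $2\le r<\infty$; $n,h\in\mathbb N$. $\mathcal A_r$ is the real Cayley-Dickson algebra of dimension $2^r$ ($\mathcal A_2$ quaternions, $\mathcal A_3$ octonions, $\mathcal A_{r+1}$ obtained from $\mathcal A_r$ by doubling) with standard basis $i_0=1,\dots,i_{2^r-1}$; for $z=\sum_l z_li_l$, $z_l\in\mathbb R$: $\tilde z=z_0-\sum_{l\ge1}z_li_l$, $|z|^2=\sum_l z_l^2$. $\mathcal A_{r,C}=\mathcal A_r\oplus\mathbf i\mathcal A_r$ is its complexification, $\mathbf i^2=-1$, $\mathbf i$ central. $\mathbb R^n=i_0\mathbb R^n\subset\mathcal A_r^n\subset\mathcal A_{r,C}^n$. $L_r(\mathcal A_{r,C}^n,\mathcal A_{r,C}^h)$ is the set of operators $J$ with $J(xb+yc)=(Jx)b+(Jy)c$ for $x,y\in\mathbb R^n$, $b,c\in\mathcal A_{r,C}$; equivalently $(Jz)_l=\sum_kJ_{l,k}z_k$ with entries $J_{l,k}\in\mathcal A_{r,C}$. $L_{r,i}$ is the subset of those $J$ with $J(\mathcal A_r^n)\subset\mathcal A_r^h$ (entries in $\mathcal A_r$). For $Q\in L_{r,i}$ the adjoint has matrix $(Q^* )_{k,l}=\widetilde{Q_{l,k}}$. Products under a trace are products of matrices, bracketed as indicated by the braces, so $\mathrm{Tr}(\{QV\}\{V^*Q^*\})=\sum_{l,j}|\sum_kQ_{l,k}V_{k,j}|^2$. Random functions. $T=[0,s]$ with $0<s<\infty$ or $T=[0,\infty)$. $U=\bigoplus_{j=1}^ma_jB_j$,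 where $B_j$ are positive definite real matrices (block sizes summing to $n$) and $a_j\in\mathcal A_r\setminus\{0\}$; $U^{1/2}=\bigoplus_ja_j^{1/2}B_j^{1/2}$, with $a_j^{1/2}\in\mathcal A_r$ a fixed square root (positive if $a_j>0$). A $U$-random function is $w(t)=U^{1/2}\xi(t)$, where $\xi$ is a standard Wiener process in $\mathbb R^n$ on a probability space $(\Omega,\mathcal F,\mathsf P)$; $E$ is the expectation with respect to $\mathsf P$. $\{\mathcal F_t:t\in T\}$ is the normal filtration induced by $w$ (normal: right-continuous, $\mathcal F_0$ contains all $\mathsf P$-null sets). $S$ is elementary if $S(t)=\sum_{l=0}^{k-1}S_l\,ch_{(t_l,t_{l+1}]}(t)$ for a finite partition $0=t_0<\dots<t_k$, with each $S_l$ being $\mathcal F_{t_l}$-measurable (with values in the operator space under consideration, here $L_{r,i}(\mathcal A_{r,C}^n,\mathcal A_{r,C}^h)$). A random function on $T\times\Omega$ is predictable if it is measurable with respect to the completion, by null sets of $\lambda\times\mathsf P$ ($\lambda$ Lebesgue measure on $T$), of the $\sigma$-algebra generated by the sets $(v,t]\times A$ with $A\in\mathcal F_v$ and $\{0\}\times A$ with $A\in\mathcal F_0$. *)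

theory Defs
  imports "HOL-Probability.Probability"
begin

section \<open>Cayley-Dickson algebras\<close>

text \<open>An element \<open>\<Sum>l<2^r. z l * i_l\<close> is represented by its coordinate function \<open>z\<close>, which vanishes
  from \<open>2^r\<close> on.  Real coordinates give the algebra \<open>A_r\<close>.  All operations are bilinear or linear
  with integer structure constants, so complex coordinates give the complexification
  \<open>A_{r,C}\<close> with a central imaginary unit (in particular \<open>cd_conj\<close> does not conjugate the
  coordinates).\<close>

definition cd_alg :: "nat \<Rightarrow> (nat \<Rightarrow> 'a::comm_ring_1) set" where
  "cd_alg r = {z. \<forall>l\<ge>2^r. z l = 0}"

definition cd_zero :: "nat \<Rightarrow> 'a::comm_ring_1" where
  "cd_zero = (\<lambda>l. 0)"

definition cd_scalar :: "'a::comm_ring_1 \<Rightarrow> nat \<Rightarrow> 'a" where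
  "cd_scalar x = (\<lambda>l. if l = 0 then x else 0)"

definition cd_conj :: "(nat \<Rightarrow> 'a::comm_ring_1) \<Rightarrow> nat \<Rightarrow> 'a" where
  "cd_conj z = (\<lambda>l. if l = 0 then z l else - z l)"

text \<open>\<open>z = cd_fst r z + cd_snd r z * i_{2^r}\<close> splits an element of the doubled algebra.\<close>

definition cd_fst :: "nat \<Rightarrow> (nat \<Rightarrow> 'a::comm_ring_1) \<Rightarrow> nat \<Rightarrow> 'a" where
  "cd_fst r z = (\<lambda>l. if l < 2^r then z l else 0)"

definition cd_snd :: "nat \<Rightarrow> (nat \<Rightarrow> 'a::comm_ring_1) \<Rightarrow> nat \<Rightarrow> 'a" where
  "cd_snd r z = (\<lambda>l. if l < 2^r then z (2^r + l) else 0)"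

text \<open>Doubling: \<open>(a + b i)(c + d i) = (a c - conj d * b) + (d a + b * conj c) i\<close>, \<open>i = i_{2^r}\<close>.\<close>

primrec cd_mult :: "nat \<Rightarrow> (nat \<Rightarrow> 'a::comm_ring_1) \<Rightarrow> (nat \<Rightarrow> 'a) \<Rightarrow> nat \<Rightarrow> 'a" where
  "cd_mult 0 x y = cd_scalar (x 0 * y 0)"
| "cd_mult (Suc r) x y = (\<lambda>l.
     if l < 2^r then
       cd_mult r (cd_fst r x) (cd_fst r y) l
         - cd_mult r (cd_conj (cd_snd r y)) (cd_snd r x) l
     else if l < 2^Suc r then
       cd_mult r (cd_snd r y) (cd_fst r x) (l - 2^r)
         + cd_mult r (cd_snd r x) (cd_conj (cd_fst r y)) (l - 2^r)
     else 0)"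


section \<open>Matrices and operators over Cayley-Dickson algebras\<close>

text \<open>Vectors of length \<open>n\<close> and \<open>h \<times> n\<close> matrices vanish outside their index ranges.\<close>

definition cd_vecs :: "nat \<Rightarrow> nat \<Rightarrow> (nat \<Rightarrow> nat \<Rightarrow> 'a::comm_ring_1) set" where
  "cd_vecs r n = {z. (\<forall>k. z k \<in> cd_alg r) \<and> (\<forall>k\<ge>n. z k = cd_zero)}"

definition cd_mats :: "nat \<Rightarrow> nat \<Rightarrow> nat \<Rightarrow> (nat \<Rightarrow> nat \<Rightarrow> nat \<Rightarrow> 'a::comm_ring_1) set" where
  "cd_mats r n h = {J. (\<forall>l k. J l k \<in> cd_alg r) \<and> (\<forall>l k. l \<ge> h \<or> k \<ge> n \<longrightarrow> J l k = cd_zero)}"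

text \<open>\<open>cd_matvec r n J\<close> is \<open>(J z)_l = \<Sum>k<n. J_{l,k} z_k\<close>; in \<open>cd_matmul r n P Q\<close>, \<open>n\<close> is the common
  inner dimension.\<close>

definition cd_matvec ::
  "nat \<Rightarrow> nat \<Rightarrow> (nat \<Rightarrow> nat \<Rightarrow> nat \<Rightarrow> 'a::comm_ring_1) \<Rightarrow> (nat \<Rightarrow> nat \<Rightarrow> 'a) \<Rightarrow> nat \<Rightarrow> nat \<Rightarrow> 'a" where
  "cd_matvec r n J z = (\<lambda>l c. \<Sum>k<n. cd_mult r (J l k) (z k) c)"

definition cd_matmul ::
  "nat \<Rightarrow> nat \<Rightarrow> (nat \<Rightarrow> nat \<Rightarrow> nat \<Rightarrow> 'a::comm_ring_1) \<Rightarrow> (nat \<Rightarrow> nat \<Rightarrow> nat \<Rightarrow> 'a)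
     \<Rightarrow> nat \<Rightarrow> nat \<Rightarrow> nat \<Rightarrow> 'a" where
  "cd_matmul r n P Q = (\<lambda>l j c. \<Sum>k<n. cd_mult r (P l k) (Q k j) c)"

definition cd_matdiff ::
  "(nat \<Rightarrow> nat \<Rightarrow> nat \<Rightarrow> 'a::comm_ring_1) \<Rightarrow> (nat \<Rightarrow> nat \<Rightarrow> nat \<Rightarrow> 'a) \<Rightarrow> nat \<Rightarrow> nat \<Rightarrow> nat \<Rightarrow> 'a" where
  "cd_matdiff P Q = (\<lambda>l k c. P l k c - Q l k c)"

definition cd_adjoint :: "(nat \<Rightarrow> nat \<Rightarrow> nat \<Rightarrow> 'a::comm_ring_1) \<Rightarrow> nat \<Rightarrow> nat \<Rightarrow> nat \<Rightarrow> 'a" where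
  "cd_adjoint Q = (\<lambda>k l. cd_conj (Q l k))"

definition cd_trace :: "nat \<Rightarrow> (nat \<Rightarrow> nat \<Rightarrow> nat \<Rightarrow> 'a::comm_ring_1) \<Rightarrow> nat \<Rightarrow> 'a" where
  "cd_trace h Q = (\<lambda>c. \<Sum>l<h. Q l l c)"

text \<open>\<open>L_r(A_{r,C}^n, A_{r,C}^h)\<close> as a set of (additive) operators, and its subset \<open>L_{r,i}\<close> of those
  mapping \<open>A_r^n\<close> to \<open>A_r^h\<close>.  Below these are identified with \<open>cd_mats r n h\<close> over the complex,
  respectively real, coordinates; see \<open>L_op_matrices\<close> and \<open>Li_op_matrices\<close>.\<close>

definition L_op ::
  "nat \<Rightarrow> nat \<Rightarrow> nat \<Rightarrow> ((nat \<Rightarrow> nat \<Rightarrow> complex) \<Rightarrow> (nat \<Rightarrow> nat \<Rightarrow> complex)) set" where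
  "L_op r n h = {J \<in> cd_vecs r n \<rightarrow>\<^sub>E cd_vecs r h.
     (\<forall>z\<in>cd_vecs r n. \<forall>z'\<in>cd_vecs r n. J (\<lambda>k c. z k c + z' k c) = (\<lambda>l c. J z l c + J z' l c)) \<and>
     (\<forall>x y :: nat \<Rightarrow> real. \<forall>b\<in>cd_alg r. \<forall>c\<in>cd_alg r.
        (\<forall>k\<ge>n. x k = 0 \<and> y k = 0) \<longrightarrow>
        J (\<lambda>k d. cd_mult r (cd_scalar (of_real (x k))) b d + cd_mult r (cd_scalar (of_real (y k))) c d)
        = (\<lambda>l d. cd_mult r (J (\<lambda>k. cd_scalar (of_real (x k))) l) b d
              + cd_mult r (J (\<lambda>k. cd_scalar (of_real (y k))) l) c d))}"

definition cd_cvec :: "(nat \<Rightarrow> nat \<Rightarrow> real) \<Rightarrow> nat \<Rightarrow> nat \<Rightarrow> complex" where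
  "cd_cvec z = (\<lambda>k c. of_real (z k c))"

definition Li_op ::
  "nat \<Rightarrow> nat \<Rightarrow> nat \<Rightarrow> ((nat \<Rightarrow> nat \<Rightarrow> complex) \<Rightarrow> (nat \<Rightarrow> nat \<Rightarrow> complex)) set" where
  "Li_op r n h = {J \<in> L_op r n h. \<forall>z\<in>cd_vecs r n. J (cd_cvec z) \<in> cd_cvec ` cd_vecs r h}"

abbreviation Li_mats :: "nat \<Rightarrow> nat \<Rightarrow> nat \<Rightarrow> (nat \<Rightarrow> nat \<Rightarrow> nat \<Rightarrow> real) set" where
  "Li_mats \<equiv> cd_mats"

lemma cd_mult_in_alg: "cd_mult r x y \<in> cd_alg r"
  by (cases r) (auto simp: cd_alg_def cd_scalar_def)

lemma cd_mult_add_both: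
  fixes x x' y :: "nat \<Rightarrow> 'a::comm_ring_1"
  shows "cd_mult r (\<lambda>l. x l + x' l) y = (\<lambda>l. cd_mult r x y l + cd_mult r x' y l) \<and>
   cd_mult r y (\<lambda>l. x l + x' l) = (\<lambda>l. cd_mult r y x l + cd_mult r y x' l)"
proof (induction r arbitrary: x x' y)
  case 0
  show ?case by (auto simp: cd_scalar_def algebra_simps)
next
  case (Suc r)
  have f: "cd_fst r (\<lambda>l. x l + x' l) = (\<lambda>l. cd_fst r x l + cd_fst r x' l)" for x x' :: "nat \<Rightarrow> 'a"
    by (auto simp: cd_fst_def)
  have s: "cd_snd r (\<lambda>l. x l + x' l) = (\<lambda>l. cd_snd r x l + cd_snd r x' l)" for x x' :: "nat \<Rightarrow> 'a"
    by (auto simp: cd_snd_def)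
  have c: "cd_conj (\<lambda>l. x l + x' l) = (\<lambda>l. cd_conj x l + cd_conj x' l)" for x x' :: "nat \<Rightarrow> 'a"
    by (auto simp: cd_conj_def)
  show ?case
    by (intro conjI ext) (simp_all add: f s c Suc.IH[THEN conjunct1] Suc.IH[THEN conjunct2])
qed

lemma cd_mult_scale_both:
  fixes x y :: "nat \<Rightarrow> 'a::comm_ring_1"
  shows "cd_mult r (\<lambda>l. a * x l) y = (\<lambda>l. a * cd_mult r x y l) \<and>
   cd_mult r y (\<lambda>l. a * x l) = (\<lambda>l. a * cd_mult r y x l)"
proof (induction r arbitrary: x y)
  case 0
  show ?case by (auto simp: cd_scalar_def algebra_simps)
next
  case (Suc r)
  have f: "cd_fst r (\<lambda>l. a * x l) = (\<lambda>l. a * cd_fst r x l)" for x :: "nat \<Rightarrow> 'a"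
    by (auto simp: cd_fst_def)
  have s: "cd_snd r (\<lambda>l. a * x l) = (\<lambda>l. a * cd_snd r x l)" for x :: "nat \<Rightarrow> 'a"
    by (auto simp: cd_snd_def)
  have c: "cd_conj (\<lambda>l. a * x l) = (\<lambda>l. a * cd_conj x l)" for x :: "nat \<Rightarrow> 'a"
    by (auto simp: cd_conj_def)
  show ?case
    by (intro conjI ext)
       (simp_all add: f s c Suc.IH[THEN conjunct1] Suc.IH[THEN conjunct2] algebra_simps)
qed

lemmas cd_mult_add_left = cd_mult_add_both[THEN conjunct1]
lemmas cd_mult_add_right = cd_mult_add_both[THEN conjunct2]
lemmas cd_mult_scale_left = cd_mult_scale_both[THEN conjunct1]
lemmas cd_mult_scale_right = cd_mult_scale_both[THEN conjunct2]

lemma cd_mult_zero_left [simp]: "cd_mult r (\<lambda>l. 0) y = (\<lambda>l. 0)"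
  using cd_mult_scale_left[of r 0 "\<lambda>l. 0" y] by simp

lemma cd_mult_zero_right [simp]: "cd_mult r y (\<lambda>l. 0) = (\<lambda>l. 0)"
  using cd_mult_scale_right[of r y 0 "\<lambda>l. 0"] by simp

lemma cd_mult_minus_left: "cd_mult r (\<lambda>l. - x l) y = (\<lambda>l. - cd_mult r x y l)"
  using cd_mult_scale_left[of r "-1" x y] by simp

lemma cd_mult_minus_right: "cd_mult r y (\<lambda>l. - x l) = (\<lambda>l. - cd_mult r y x l)"
  using cd_mult_scale_right[of r y "-1" x] by simp

lemma cd_mult_one_both:
  fixes z :: "nat \<Rightarrow> 'a::comm_ring_1"
  assumes "z \<in> cd_alg r"
  shows "cd_mult r (cd_scalar 1) z = z \<and> cd_mult r z (cd_scalar 1) = z"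
  using assms
proof (induction r arbitrary: z)
  case 0
  then show ?case by (auto simp: cd_scalar_def cd_alg_def fun_eq_iff)
next
  case (Suc r)
  have 1: "cd_fst r (cd_scalar 1) = (cd_scalar 1 :: nat \<Rightarrow> 'a)"
    "cd_snd r (cd_scalar 1) = (\<lambda>l. 0 :: 'a)" "cd_conj (\<lambda>l. 0::'a) = (\<lambda>l. 0)"
    "cd_conj (cd_scalar 1) = (cd_scalar 1 :: nat \<Rightarrow> 'a)"
    by (auto simp: cd_fst_def cd_snd_def cd_scalar_def cd_conj_def)
  have 2: "cd_fst r z \<in> cd_alg r" "cd_snd r z \<in> cd_alg r"
    by (auto simp: cd_fst_def cd_snd_def cd_alg_def)
  have 3: "(if l < 2^r then cd_fst r z l else if l < 2^Suc r then cd_snd r z (l - 2^r) else 0) = z l"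
    for l
    using Suc.prems by (auto simp: cd_fst_def cd_snd_def cd_alg_def not_less)
  show ?case
    by (intro conjI ext; subst (2) 3[symmetric])
       (simp_all add: 1 Suc.IH[OF 2(1)] Suc.IH[OF 2(2)])
qed

lemma cd_mult_scalar_left: "z \<in> cd_alg r \<Longrightarrow> cd_mult r (cd_scalar a) z = (\<lambda>l. a * z l)"
  using cd_mult_scale_left[of r a "cd_scalar 1" z] cd_mult_one_both[of z r]
  by (simp add: cd_scalar_def if_distrib cong: if_cong)

lemma cd_mult_scalar_right: "z \<in> cd_alg r \<Longrightarrow> cd_mult r z (cd_scalar a) = (\<lambda>l. a * z l)"
  using cd_mult_scale_right[of r z a "cd_scalar 1"] cd_mult_one_both[of z r]
  by (simp add: cd_scalar_def if_distrib cong: if_cong)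

lemma cd_conj_conj [simp]: "cd_conj (cd_conj z) = z"
  by (auto simp: cd_conj_def)

lemma cd_conj_mult:
  fixes x y :: "nat \<Rightarrow> 'a::comm_ring_1"
  shows "cd_conj (cd_mult r x y) = cd_mult r (cd_conj y) (cd_conj x)"
proof (induction r arbitrary: x y)
  case 0
  show ?case by (auto simp: cd_conj_def cd_scalar_def)
next
  case (Suc r)
  have f: "cd_fst r (cd_conj z) = cd_conj (cd_fst r z)" for z :: "nat \<Rightarrow> 'a"
    by (auto simp: cd_fst_def cd_conj_def)
  have s: "cd_snd r (cd_conj z) = (\<lambda>l. - cd_snd r z l)" for z :: "nat \<Rightarrow> 'a"
    by (auto simp: cd_snd_def cd_conj_def)
  have c: "cd_conj (\<lambda>l. - z l) = (\<lambda>l. - cd_conj z l)" for z :: "nat \<Rightarrow> 'a"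
    by (auto simp: cd_conj_def)
  have m0: "cd_mult r (cd_conj u) (cd_conj v) = cd_conj (cd_mult r v u)" for u v :: "nat \<Rightarrow> 'a"
    by (simp add: Suc.IH)
  have m1: "cd_mult r (cd_conj v) u = cd_conj (cd_mult r (cd_conj u) v)" for u v :: "nat \<Rightarrow> 'a"
    by (simp add: Suc.IH)
  show ?case
  proof (rule ext)
    fix l
    show "cd_conj (cd_mult (Suc r) x y) l = cd_mult (Suc r) (cd_conj y) (cd_conj x) l"
      unfolding cd_mult.simps f s c cd_mult_minus_left cd_mult_minus_right m0
        m1[of "cd_snd r y" "cd_snd r x"]
      by (cases "l = 0") (simp_all add: cd_conj_def[of "cd_mult _ _ _"] cd_conj_def[of "\<lambda>l. if _ l then _ l else _ l"])
  qed
qed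

lemma cd_mult_conj:
  fixes z :: "nat \<Rightarrow> 'a::comm_ring_1"
  assumes "z \<in> cd_alg r"
  shows "cd_mult r z (cd_conj z) = cd_scalar (\<Sum>l<2^r. (z l)\<^sup>2)"
  using assms
proof (induction r arbitrary: z)
  case 0
  show ?case by (auto simp: cd_conj_def power2_eq_square)
next
  case (Suc r)
  have f: "cd_fst r (cd_conj z) = cd_conj (cd_fst r z)"
    by (auto simp: cd_fst_def cd_conj_def)
  have s: "cd_snd r (cd_conj z) = (\<lambda>l. - cd_snd r z l)"
    by (auto simp: cd_snd_def cd_conj_def)
  have c: "cd_conj (\<lambda>l. - z l) = (\<lambda>l. - cd_conj z l)" for z :: "nat \<Rightarrow> 'a"
    by (auto simp: cd_conj_def)
  have 1: "cd_mult r (cd_fst r z) (cd_conj (cd_fst r z)) = cd_scalar (\<Sum>l<2^r. (cd_fst r z l)\<^sup>2)"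
    by (rule Suc.IH) (auto simp: cd_alg_def cd_fst_def)
  have 2: "cd_mult r (cd_conj (cd_snd r z)) (cd_conj (cd_conj (cd_snd r z)))
      = cd_scalar (\<Sum>l<2^r. (cd_conj (cd_snd r z) l)\<^sup>2)"
    by (rule Suc.IH) (auto simp: cd_alg_def cd_snd_def cd_conj_def)
  have 3: "(\<Sum>l<2^r. (cd_fst r z l)\<^sup>2) = (\<Sum>l<2^r. (z l)\<^sup>2)"
    by (rule sum.cong) (auto simp: cd_fst_def)
  have 4: "(\<Sum>l<2^r. (cd_conj (cd_snd r z) l)\<^sup>2) = (\<Sum>l<2^r. (z (2^r + l))\<^sup>2)"
    by (rule sum.cong) (auto simp: cd_snd_def cd_conj_def)
  have 5: "(\<Sum>l<2^Suc r. (z l)\<^sup>2) = (\<Sum>l<2^r. (z l)\<^sup>2) + (\<Sum>l<2^r. (z (2^r + l))\<^sup>2)"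
    using sum.atLeastLessThan_concat[of 0 "2^r" "2^Suc r" "\<lambda>l. (z l)\<^sup>2"]
      sum.shift_bounds_nat_ivl[of "\<lambda>l. (z l)\<^sup>2" 0 "2^r" "2^r"]
    by (simp add: lessThan_atLeast0 add.commute mult_2)
  show ?case
  proof (rule ext)
    fix l
    show "cd_mult (Suc r) z (cd_conj z) l = cd_scalar (\<Sum>l<2^Suc r. (z l)\<^sup>2) l"
      using 2 unfolding 5
      by (simp add: f s c cd_mult_minus_left cd_mult_minus_right 1 3 4)
         (auto simp: cd_scalar_def)
  qed
qed


lemma cd_mult_sum_left: "cd_mult r (\<lambda>c. \<Sum>i\<in>I. f i c) y = (\<lambda>c. \<Sum>i\<in>I. cd_mult r (f i) y c)"
  by (induction I rule: infinite_finite_induct) (simp_all add: cd_mult_add_left)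

lemma cd_conj_sum: "cd_conj (\<lambda>c. \<Sum>i\<in>I. f i c) = (\<lambda>c. \<Sum>i\<in>I. cd_conj (f i) c)"
  by (auto simp: cd_conj_def sum_negf)

lemma cd_alg_sum: "(\<And>i. i \<in> I \<Longrightarrow> f i \<in> cd_alg r) \<Longrightarrow> (\<lambda>c. \<Sum>i\<in>I. f i c) \<in> cd_alg r"
  by (auto simp: cd_alg_def)

text \<open>\<open>Tr({S V}{V^* S^*})\<close> is a real number, the sum of the squares of all real coordinates of \<open>S V\<close>.\<close>

lemma cd_trace_gram:
  "cd_trace h (cd_matmul r n (cd_matmul r n S V) (cd_matmul r n (cd_adjoint V) (cd_adjoint S)))
   = cd_scalar (\<Sum>l<h. \<Sum>j<n. \<Sum>c<2^r. (cd_matmul r n S V l j c)\<^sup>2)"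
proof -
  have adj: "cd_matmul r n (cd_adjoint V) (cd_adjoint S) j l = cd_conj (cd_matmul r n S V l j)" for j l
    by (simp add: cd_matmul_def cd_adjoint_def cd_conj_sum cd_conj_mult)
  have alg: "cd_matmul r n S V l j \<in> cd_alg r" for l j
    unfolding cd_matmul_def by (rule cd_alg_sum) (rule cd_mult_in_alg)
  have "cd_matmul r n P Q l l = (\<lambda>c. \<Sum>j<n. cd_mult r (P l j) (Q j l) c)" for P Q :: "nat \<Rightarrow> nat \<Rightarrow> nat \<Rightarrow> 'a" and l
    by (simp add: cd_matmul_def)
  then show ?thesis
    by (simp add: cd_trace_def adj cd_mult_conj[OF alg]) (auto simp: cd_scalar_def fun_eq_iff)
qed

lemma cd_matvec_in_vecs: "Q \<in> cd_mats r n h \<Longrightarrow> cd_matvec r n Q z \<in> cd_vecs r h"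
  unfolding cd_vecs_def cd_matvec_def
  by (auto simp: cd_mats_def cd_zero_def intro!: cd_alg_sum cd_mult_in_alg)

lemma cd_matvec_unit:
  fixes Q :: "nat \<Rightarrow> nat \<Rightarrow> nat \<Rightarrow> 'a::comm_ring_1"
  assumes "Q \<in> cd_mats r n h" "k < n"
  shows "cd_matvec r n Q (\<lambda>i. cd_scalar (if i = k then 1 else 0)) = (\<lambda>l. Q l k)"
proof -
  have "Q l i \<in> cd_alg r" for l i
    using assms by (auto simp: cd_mats_def)
  then show ?thesis
    using assms by (simp add: cd_matvec_def cd_mult_scalar_right if_distrib[of "\<lambda>x. x * _"] sum.delta cong: if_cong)
qed

lemma unit_in_vecs: "k < n \<Longrightarrow> (\<lambda>i. cd_scalar (if i = k then 1 else 0)) \<in> cd_vecs r n"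
  by (auto simp: cd_vecs_def cd_alg_def cd_scalar_def cd_zero_def fun_eq_iff)

lemma L_op_matrices:
  "bij_betw (\<lambda>Q. restrict (cd_matvec r n Q) (cd_vecs r n)) (cd_mats r n h) (L_op r n h)"
proof (rule bij_betw_imageI)
  show "inj_on (\<lambda>Q. restrict (cd_matvec r n Q) (cd_vecs r n)) (cd_mats r n h :: (nat \<Rightarrow> nat \<Rightarrow> nat \<Rightarrow> complex) set)"
  proof (rule inj_onI)
    fix P Q :: "nat \<Rightarrow> nat \<Rightarrow> nat \<Rightarrow> complex"
    assume P: "P \<in> cd_mats r n h" and Q: "Q \<in> cd_mats r n h"
      and eq: "restrict (cd_matvec r n P) (cd_vecs r n) = restrict (cd_matvec r n Q) (cd_vecs r n)"
    have "P l k = Q l k" for l k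
    proof (cases "k < n")
      case True
      have "(\<lambda>i. cd_scalar (if i = k then 1 else 0)) \<in> (cd_vecs r n :: (nat \<Rightarrow> nat \<Rightarrow> complex) set)"
        by (rule unit_in_vecs[OF True])
      then have "(\<lambda>l. P l k) = (\<lambda>l. Q l k)"
        using fun_cong[OF eq, of "\<lambda>i. cd_scalar (if i = k then 1 else 0)"]
        by (simp add: cd_matvec_unit[OF P True] cd_matvec_unit[OF Q True])
      then show ?thesis by (simp add: fun_eq_iff)
    next
      case False
      then show ?thesis using P Q by (auto simp: cd_mats_def)
    qed
    then show "P = Q" by (intro ext) simp
  qed
next
  show "(\<lambda>Q. restrict (cd_matvec r n Q) (cd_vecs r n)) ` cd_mats r n h = L_op r n h"
  proof (intro subset_antisym subsetI)
    fix J :: "(nat \<Rightarrow> nat \<Rightarrow> complex) \<Rightarrow> nat \<Rightarrow> nat \<Rightarrow> complex"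
    assume "J \<in> (\<lambda>Q. restrict (cd_matvec r n Q) (cd_vecs r n)) ` cd_mats r n h"
    then obtain Q :: "nat \<Rightarrow> nat \<Rightarrow> nat \<Rightarrow> complex"
      where Q: "Q \<in> cd_mats r n h" and J: "J = restrict (cd_matvec r n Q) (cd_vecs r n)"
      by auto
    have QA: "Q l k \<in> cd_alg r" for l k
      using Q by (auto simp: cd_mats_def)
    have add: "(\<lambda>k c. z k c + z' k c) \<in> cd_vecs r n"
      if "z \<in> cd_vecs r n" "z' \<in> cd_vecs r n" for z z' :: "nat \<Rightarrow> nat \<Rightarrow> complex"
      using that by (auto simp: cd_vecs_def cd_alg_def cd_zero_def fun_eq_iff)
    have sc: "(\<lambda>k. cd_scalar (of_real (x k))) \<in> cd_vecs r n"
      if "\<forall>k\<ge>n. x k = 0" for x :: "nat \<Rightarrow> real"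
      using that by (auto simp: cd_vecs_def cd_alg_def cd_scalar_def cd_zero_def fun_eq_iff)
    have scb: "(\<lambda>k d. cd_mult r (cd_scalar (of_real (x k))) b d) \<in> cd_vecs r n"
      if "\<forall>k\<ge>n. x k = 0" "b \<in> cd_alg r" for x :: "nat \<Rightarrow> real" and b :: "nat \<Rightarrow> complex"
      using that by (auto simp: cd_vecs_def cd_mult_scalar_left cd_alg_def cd_zero_def fun_eq_iff)
    have mv_add: "cd_matvec r n Q (\<lambda>k c. z k c + z' k c) = (\<lambda>l c. cd_matvec r n Q z l c + cd_matvec r n Q z' l c)" for z z'
      by (simp add: cd_matvec_def cd_mult_add_right sum.distrib)
    have mv_sc: "cd_matvec r n Q (\<lambda>k d. cd_mult r (cd_scalar (of_real (x k))) b d)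
        = (\<lambda>l d. cd_mult r (cd_matvec r n Q (\<lambda>k. cd_scalar (of_real (x k))) l) b d)"
      if "b \<in> cd_alg r" for x :: "nat \<Rightarrow> real" and b
      by (simp add: cd_matvec_def cd_mult_sum_left cd_mult_scalar_right[OF QA]
          cd_mult_scalar_left[OF that] cd_mult_scale_left cd_mult_scale_right)
    show "J \<in> L_op r n h"
      unfolding L_op_def
    proof (intro CollectI conjI ballI allI impI)
      show "J \<in> cd_vecs r n \<rightarrow>\<^sub>E cd_vecs r h"
        using Q J by (auto simp: cd_matvec_in_vecs)
    qed (auto simp: J add sc scb mv_add mv_sc)
  next
    fix J assume "J \<in> L_op r n h"
    then have JE: "J \<in> cd_vecs r n \<rightarrow>\<^sub>E cd_vecs r h"
      and Jadd: "\<And>z z'. z \<in> cd_vecs r n \<Longrightarrow> z' \<in> cd_vecs r n \<Longrightarrow>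
        J (\<lambda>k c. z k c + z' k c) = (\<lambda>l c. J z l c + J z' l c)"
      and Jlin: "\<And>(x :: nat \<Rightarrow> real) (y :: nat \<Rightarrow> real) b c. b \<in> cd_alg r \<Longrightarrow> c \<in> cd_alg r \<Longrightarrow> \<forall>k\<ge>n. x k = 0 \<and> y k = 0 \<Longrightarrow>
        J (\<lambda>k d. cd_mult r (cd_scalar (of_real (x k))) b d + cd_mult r (cd_scalar (of_real (y k))) c d)
        = (\<lambda>l d. cd_mult r (J (\<lambda>k. cd_scalar (of_real (x k))) l) b d
              + cd_mult r (J (\<lambda>k. cd_scalar (of_real (y k))) l) c d)"
      unfolding L_op_def by blast+
    define e :: "nat \<Rightarrow> nat \<Rightarrow> nat \<Rightarrow> complex"
      where "e = (\<lambda>k i. cd_scalar (if i = k then 1 else 0))"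
    define Q where "Q = (\<lambda>l k. if k < n then J (e k) l else cd_zero)"
    have e: "e k \<in> cd_vecs r n" if "k < n" for k
      using unit_in_vecs[OF that] by (simp add: e_def)
    have Je: "J (e k) \<in> cd_vecs r h" if "k < n" for k
      using JE e[OF that] by auto
    have Q: "Q \<in> cd_mats r n h"
      using Je by (auto simp: cd_mats_def cd_vecs_def Q_def) (auto simp: cd_alg_def cd_zero_def)
    have mono: "J (\<lambda>i. if i = k then b else cd_zero) = (\<lambda>l. cd_mult r (J (e k) l) b)"
      if k: "k < n" and b: "b \<in> cd_alg r" for k b
    proof -
      define x :: "nat \<Rightarrow> real" where "x = (\<lambda>i. if i = k then 1 else 0)"
      have x: "(\<lambda>i. cd_scalar (of_real (x i))) = e k"
        by (auto simp: x_def e_def fun_eq_iff)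
      have z: "(\<lambda>l. 0::complex) \<in> cd_alg r"
        by (simp add: cd_alg_def)
      have "(\<lambda>i d. cd_mult r (cd_scalar (of_real (x i))) b d) = (\<lambda>i. if i = k then b else cd_zero)"
        by (auto simp: x_def cd_mult_scalar_left[OF b] cd_zero_def fun_eq_iff)
      then show ?thesis
        using Jlin[OF b z, of x "\<lambda>i. 0"] k by (simp add: x) (simp add: x_def)
    qed
    have "J z = cd_matvec r n Q z" if z: "z \<in> cd_vecs r n" for z
    proof -
      have za: "z k \<in> cd_alg r" for k
        using z by (auto simp: cd_vecs_def)
      have "J (\<lambda>i. if i < m then z i else cd_zero) = (\<lambda>l c. \<Sum>k<m. cd_mult r (J (e k) l) (z k) c)"
        if "m \<le> n" for m
        using that
      proof (induction m)
        case 0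
        have zero: "(\<lambda>i. cd_zero) \<in> cd_vecs r n"
          by (auto simp: cd_vecs_def cd_alg_def cd_zero_def)
        show ?case
          using Jadd[OF zero zero] by (simp add: cd_zero_def fun_eq_iff)
      next
        case (Suc m)
        have 1: "(\<lambda>i. if i < m then z i else cd_zero) \<in> cd_vecs r n"
          "(\<lambda>i. if i = m then z i else cd_zero) \<in> cd_vecs r n"
          using z by (auto simp: cd_vecs_def cd_alg_def cd_zero_def fun_eq_iff)
        have 2: "(\<lambda>i. if i < Suc m then z i else cd_zero)
          = (\<lambda>i c. (if i < m then z i else cd_zero) c + (if i = m then z i else cd_zero) c)"
          by (auto simp: cd_zero_def fun_eq_iff less_Suc_eq)
        have 3: "(\<lambda>i. if i = m then z i else cd_zero) = (\<lambda>i. if i = m then z m else cd_zero)"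
          by auto
        show ?case
          unfolding 2 Jadd[OF 1] using Suc mono[of m "z m", OF _ za] by (simp add: 3)
      qed
      from this[of n] have "J (\<lambda>i. if i < n then z i else cd_zero) = cd_matvec r n Q z"
        by (simp add: cd_matvec_def Q_def)
      moreover have "(\<lambda>i. if i < n then z i else cd_zero) = z"
        using z by (auto simp: cd_vecs_def fun_eq_iff)
      ultimately show ?thesis by simp
    qed
    then have "J = restrict (cd_matvec r n Q) (cd_vecs r n)"
      using JE by (auto simp: PiE_def extensional_def fun_eq_iff)
    with Q show "J \<in> (\<lambda>Q. restrict (cd_matvec r n Q) (cd_vecs r n)) ` cd_mats r n h"
      by blast
  qed
qed

lemma cd_mult_of_real:
  "cd_mult r (\<lambda>l. complex_of_real (x l)) (\<lambda>l. complex_of_real (y l))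
   = (\<lambda>l. complex_of_real (cd_mult r x y l))"
proof (induction r arbitrary: x y)
  case 0
  show ?case by (auto simp: cd_scalar_def)
next
  case (Suc r)
  have f: "cd_fst r (\<lambda>l. complex_of_real (x l)) = (\<lambda>l. complex_of_real (cd_fst r x l))" for x
    by (auto simp: cd_fst_def)
  have s: "cd_snd r (\<lambda>l. complex_of_real (x l)) = (\<lambda>l. complex_of_real (cd_snd r x l))" for x
    by (auto simp: cd_snd_def)
  have c: "cd_conj (\<lambda>l. complex_of_real (x l)) = (\<lambda>l. complex_of_real (cd_conj x l))" for x
    by (auto simp: cd_conj_def)
  show ?case
    by (intro ext) (simp add: f s c Suc.IH)
qed

lemma Li_op_matrices:
  "bij_betw (\<lambda>Q. restrict (cd_matvec r n (\<lambda>l k c. complex_of_real (Q l k c))) (cd_vecs r n))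
     (Li_mats r n h) (Li_op r n h)"
proof -
  define C where "C = (\<lambda>Q :: nat \<Rightarrow> nat \<Rightarrow> nat \<Rightarrow> real. \<lambda>l k c. complex_of_real (Q l k c))"
  define \<Phi> where "\<Phi> = (\<lambda>Q :: nat \<Rightarrow> nat \<Rightarrow> nat \<Rightarrow> complex. restrict (cd_matvec r n Q) (cd_vecs r n))"
  have \<Phi>: "bij_betw \<Phi> (cd_mats r n h) (L_op r n h)"
    unfolding \<Phi>_def by (rule L_op_matrices)
  have C_mats: "C Q \<in> cd_mats r n h \<longleftrightarrow> Q \<in> cd_mats r n h" for Q
    by (auto simp: C_def cd_mats_def cd_alg_def cd_zero_def fun_eq_iff)
  have C_inj: "inj_on C A" for A
    by (auto simp: C_def inj_on_def fun_eq_iff)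
  have cvecs: "cd_cvec z \<in> cd_vecs r n \<longleftrightarrow> z \<in> cd_vecs r n" for z n
    by (auto simp: cd_cvec_def cd_vecs_def cd_alg_def cd_zero_def fun_eq_iff)
  have mv: "cd_matvec r n (C Q) (cd_cvec z) = cd_cvec (cd_matvec r n Q z)" for Q z
    by (simp add: C_def cd_cvec_def cd_matvec_def cd_mult_of_real)
  have "(\<lambda>Q. \<Phi> (C Q)) ` cd_mats r n h = Li_op r n h"
  proof (intro subset_antisym subsetI)
    fix J assume "J \<in> (\<lambda>Q. \<Phi> (C Q)) ` cd_mats r n h"
    then obtain Q where Q: "Q \<in> cd_mats r n h" "J = \<Phi> (C Q)"
      by auto
    have "J \<in> L_op r n h"
      using Q \<Phi> C_mats[of Q] by (auto simp: bij_betw_def)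
    moreover have "J (cd_cvec z) \<in> cd_cvec ` cd_vecs r h" if "z \<in> cd_vecs r n" for z
      using that Q cd_matvec_in_vecs[OF Q(1), of z] by (auto simp: \<Phi>_def mv cvecs)
    ultimately show "J \<in> Li_op r n h"
      by (auto simp: Li_op_def)
  next
    fix J assume J: "J \<in> Li_op r n h"
    then have "J \<in> \<Phi> ` cd_mats r n h"
      using \<Phi> by (auto simp: bij_betw_def Li_op_def)
    then obtain P where P: "P \<in> cd_mats r n h" "J = \<Phi> P"
      by auto
    have real: "P l k c = complex_of_real (Re (P l k c))" for l k c
    proof (cases "k < n")
      case True
      define e :: "nat \<Rightarrow> nat \<Rightarrow> real" where "e = (\<lambda>i. cd_scalar (if i = k then 1 else 0))"
      have ce: "cd_cvec e = (\<lambda>i. cd_scalar (if i = k then 1 else 0))"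
        by (auto simp: cd_cvec_def e_def cd_scalar_def fun_eq_iff)
      have e: "e \<in> cd_vecs r n"
        unfolding e_def by (rule unit_in_vecs[OF True])
      have "J (cd_cvec e) = (\<lambda>l. P l k)"
        using e cd_matvec_unit[OF P(1) True] by (simp add: P(2) \<Phi>_def cvecs) (simp add: ce)
      moreover have "J (cd_cvec e) \<in> cd_cvec ` cd_vecs r h"
        using J e by (simp add: Li_op_def)
      ultimately have "(\<lambda>l. P l k) \<in> cd_cvec ` cd_vecs r h"
        by simp
      then obtain y where y: "(\<lambda>l. P l k) = cd_cvec y" by auto
      show ?thesis
        using fun_cong[OF fun_cong[OF y, of l], of c] by (simp add: cd_cvec_def)
    next
      case False
      then show ?thesis using P by (auto simp: cd_mats_def cd_zero_def)
    qed
    have "P = C (\<lambda>l k c. Re (P l k c))"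
      unfolding C_def by (intro ext) (rule real)
    then show "J \<in> (\<lambda>Q. \<Phi> (C Q)) ` cd_mats r n h"
      using P C_mats by (metis imageI)
  qed
  moreover have "inj_on (\<lambda>Q. \<Phi> (C Q)) (cd_mats r n h)"
    using comp_inj_on[OF C_inj[of "cd_mats r n h"], of \<Phi>] \<Phi> C_mats
    by (auto simp: bij_betw_def comp_def intro: inj_on_subset)
  ultimately have "bij_betw (\<lambda>Q. \<Phi> (C Q)) (cd_mats r n h) (Li_op r n h)"
    by (simp add: bij_betw_def)
  then show ?thesis
    by (simp add: \<Phi>_def C_def)
qed


section \<open>The operator \<open>U\<close> and its square root\<close>

definition pos_def_matrix :: "nat \<Rightarrow> (nat \<Rightarrow> nat \<Rightarrow> real) \<Rightarrow> bool" where
  "pos_def_matrix d B \<longleftrightarrow> (\<forall>p<d. \<forall>q<d. B p q = B q p) \<and>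
     (\<forall>x. (\<exists>p<d. x p \<noteq> 0) \<longrightarrow> 0 < (\<Sum>p<d. \<Sum>q<d. x p * B p q * x q))"

text \<open>The block diagonal matrix with the blocks \<open>a j * B j\<close> of size \<open>d j\<close>, \<open>j < m\<close>.\<close>

definition block_sum ::
  "nat \<Rightarrow> (nat \<Rightarrow> nat) \<Rightarrow> (nat \<Rightarrow> nat \<Rightarrow> real) \<Rightarrow> (nat \<Rightarrow> nat \<Rightarrow> nat \<Rightarrow> real) \<Rightarrow> nat \<Rightarrow> nat \<Rightarrow> nat \<Rightarrow> real" where
  "block_sum m d a B = (\<lambda>p q c. \<Sum>j<m. let s = (\<Sum>i<j. d i) in
     if p \<in> {s..<s + d j} \<and> q \<in> {s..<s + d j} then a j c * B j (p - s) (q - s) else 0)"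

text \<open>\<open>V\<close> is a square root \<open>U^{1/2}\<close> of \<open>U\<close>; it depends on the choice of the square roots \<open>a' j\<close>
  of the \<open>a j\<close> in \<open>A_r\<close>, while \<open>B' j\<close> is the positive definite square root of \<open>B j\<close>.\<close>

definition block_sqrt ::
  "nat \<Rightarrow> nat \<Rightarrow> (nat \<Rightarrow> nat \<Rightarrow> nat \<Rightarrow> real) \<Rightarrow> (nat \<Rightarrow> nat \<Rightarrow> nat \<Rightarrow> real) \<Rightarrow> bool" where
  "block_sqrt r n U V \<longleftrightarrow> (\<exists>m d a B a' B'.
     n = (\<Sum>j<m. d j) \<and>
     (\<forall>j<m.
        a j \<in> cd_alg r \<and> a j \<noteq> cd_zero \<and> pos_def_matrix (d j) (B j) \<and>
        a' j \<in> cd_alg r \<and> cd_mult r (a' j) (a' j) = a j \<and>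
        (\<forall>x>0. a j = cd_scalar x \<longrightarrow> (\<exists>y>0. a' j = cd_scalar y)) \<and>
        pos_def_matrix (d j) (B' j) \<and>
        (\<forall>p<d j. \<forall>q<d j. (\<Sum>k<d j. B' j p k * B' j k q) = B j p q)) \<and>
     U = block_sum m d a B \<and> V = block_sum m d a' B')"


section \<open>Random functions\<close>

definition wiener_process :: "'w measure \<Rightarrow> real set \<Rightarrow> nat \<Rightarrow> (real \<Rightarrow> 'w \<Rightarrow> nat \<Rightarrow> real) \<Rightarrow> bool" where
  "wiener_process M T n \<xi> \<longleftrightarrow>
     (\<forall>t\<in>T. \<forall>k<n. (\<lambda>\<omega>. \<xi> t \<omega> k) \<in> borel_measurable M) \<and>
     (AE \<omega> in M. \<forall>k<n. \<xi> 0 \<omega> k = 0) \<and>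
     (AE \<omega> in M. \<forall>k<n. continuous_on T (\<lambda>t. \<xi> t \<omega> k)) \<and>
     (\<forall>u\<in>T. \<forall>t\<in>T. u < t \<longrightarrow> (\<forall>k<n.
        distributed M lborel (\<lambda>\<omega>. \<xi> t \<omega> k - \<xi> u \<omega> k) (\<lambda>x. ennreal (normal_density 0 (sqrt (t - u)) x)))) \<and>
     (\<forall>p (\<tau> :: nat \<Rightarrow> real). (\<forall>i\<le>p. \<tau> i \<in> T) \<and> (\<forall>i<p. \<tau> i < \<tau> (Suc i)) \<longrightarrow>
        prob_space.indep_vars M (\<lambda>_. borel)
          (\<lambda>(i, k) \<omega>. \<xi> (\<tau> (Suc i)) \<omega> k - \<xi> (\<tau> i) \<omega> k) ({..<p} \<times> {..<n}))"

text \<open>\<open>V\<close> plays the role of \<open>U^{1/2}\<close>.\<close>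

definition U_random_function ::
  "'w measure \<Rightarrow> real set \<Rightarrow> nat \<Rightarrow> nat \<Rightarrow> (nat \<Rightarrow> nat \<Rightarrow> nat \<Rightarrow> real) \<Rightarrow> (nat \<Rightarrow> nat \<Rightarrow> nat \<Rightarrow> real)
     \<Rightarrow> (real \<Rightarrow> 'w \<Rightarrow> nat \<Rightarrow> nat \<Rightarrow> real) \<Rightarrow> bool" where
  "U_random_function M T r n U V w \<longleftrightarrow> block_sqrt r n U V \<and>
     (\<exists>\<xi>. wiener_process M T n \<xi> \<and>
        (\<forall>t\<in>T. \<forall>\<omega>\<in>space M. w t \<omega> = cd_matvec r n V (\<lambda>k. cd_scalar (if k < n then \<xi> t \<omega> k else 0))))"

text \<open>The normal filtration induced by \<open>w\<close>: the filtration generated by \<open>w\<close> is augmented by the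
  null sets and then made right-continuous (nothing happens at a right end point of \<open>T\<close>).  Spaces
  of coordinate functions carry the product topology, so Borel measurability is measurability of
  all coordinates.\<close>

definition augmented_filtration ::
  "'w measure \<Rightarrow> real set \<Rightarrow> (real \<Rightarrow> 'w \<Rightarrow> nat \<Rightarrow> nat \<Rightarrow> real) \<Rightarrow> real \<Rightarrow> 'w measure" where
  "augmented_filtration M T w t = sigma (space M)
     ({w u -` A \<inter> space M |u A. u \<in> T \<and> u \<le> t \<and> A \<in> sets borel} \<union> null_sets M)"

definition normal_filtration ::
  "'w measure \<Rightarrow> real set \<Rightarrow> (real \<Rightarrow> 'w \<Rightarrow> nat \<Rightarrow> nat \<Rightarrow> real) \<Rightarrow> real \<Rightarrow> 'w measure" where
  "normal_filtration M T w t = sigma (space M)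
     (\<Inter>v\<in>{v\<in>T. t < v \<or> v = t \<and> (\<forall>u\<in>T. u \<le> t)}. sets (augmented_filtration M T w v))"

definition elementary_function ::
  "'w measure \<Rightarrow> real set \<Rightarrow> (real \<Rightarrow> 'w measure) \<Rightarrow> (nat \<Rightarrow> nat \<Rightarrow> nat \<Rightarrow> real) set
     \<Rightarrow> (real \<Rightarrow> 'w \<Rightarrow> nat \<Rightarrow> nat \<Rightarrow> nat \<Rightarrow> real) \<Rightarrow> bool" where
  "elementary_function M T \<F> L S \<longleftrightarrow> (\<exists>k (\<tau> :: nat \<Rightarrow> real) R.
     0 < k \<and> \<tau> 0 = 0 \<and> (\<forall>i<k. \<tau> i < \<tau> (Suc i)) \<and> (\<forall>i\<le>k. \<tau> i \<in> T) \<and>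
     (\<forall>i<k. (\<forall>\<omega>\<in>space M. R i \<omega> \<in> L) \<and> R i \<in> borel_measurable (\<F> (\<tau> i))) \<and>
     (\<forall>t\<in>T. \<forall>\<omega>\<in>space M.
        S t \<omega> = (\<lambda>p q c. \<Sum>i<k. indicat_real {\<tau> i<..\<tau> (Suc i)} t * R i \<omega> p q c)))"

text \<open>Null sets of \<open>\<lambda> \<times> P\<close> are taken in the completed sense, that is, arbitrary subsets of
  measurable sets of measure zero are included.\<close>

definition predictable_algebra ::
  "'w measure \<Rightarrow> real set \<Rightarrow> (real \<Rightarrow> 'w measure) \<Rightarrow> (real \<times> 'w) measure" where
  "predictable_algebra M T \<F> = sigma (T \<times> space M)
     ({{v<..t} \<times> A |v t A. v \<in> T \<and> t \<in> T \<and> v < t \<and> A \<in> sets (\<F> v)} \<union>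
      {{0} \<times> A |A. A \<in> sets (\<F> 0)} \<union>
      null_sets (completion (restrict_space lborel T \<Otimes>\<^sub>M M)))"

definition predictable ::
  "'w measure \<Rightarrow> real set \<Rightarrow> (real \<Rightarrow> 'w measure) \<Rightarrow> (real \<Rightarrow> 'w \<Rightarrow> nat \<Rightarrow> nat \<Rightarrow> nat \<Rightarrow> real) \<Rightarrow> bool" where
  "predictable M T \<F> S \<longleftrightarrow> (\<lambda>(t, \<omega>). S t \<omega>) \<in> borel_measurable (predictable_algebra M T \<F>)"

text \<open>\<open>E[\<integral>_a^t Tr({S V}{V^* S^*}) d\<tau>]\<close>, with values in \<open>[0, \<infinity>]\<close>.  The trace is a real
  number (\<open>cd_trace_gram\<close>), namely its coordinate \<open>0\<close>.\<close>

definition expected_trace_integral ::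
  "'w measure \<Rightarrow> nat \<Rightarrow> nat \<Rightarrow> nat \<Rightarrow> (nat \<Rightarrow> nat \<Rightarrow> nat \<Rightarrow> real) \<Rightarrow> real \<Rightarrow> real
     \<Rightarrow> (real \<Rightarrow> 'w \<Rightarrow> nat \<Rightarrow> nat \<Rightarrow> nat \<Rightarrow> real) \<Rightarrow> ennreal" where
  "expected_trace_integral M r n h V a t S =
     (\<integral>\<^sup>+\<omega>. (\<integral>\<^sup>+\<tau>\<in>{a..t}. ennreal (cd_trace h
        (cd_matmul r n (cd_matmul r n (S \<tau> \<omega>) V) (cd_matmul r n (cd_adjoint V) (cd_adjoint (S \<tau> \<omega>)))) 0)
      \<partial>lebesgue) \<partial>M)"

end

theory Submission
  imports Defs
begin

text \<open>The functions that are square integrable limits of step functions on every \<open>[0,t] \<times> \<Omega>\<close> form a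
  vector space closed under bounded pointwise limits, and contain the indicators of the sets
  generating the predictable \<open>\<sigma>\<close>-algebra.  By Dynkin's theorem they contain all bounded predictable
  functions.  The trace is a quadratic form \<open>q(S)\<close> in finitely many real entries of \<open>S\<close>; dominated
  convergence reduces to bounded \<open>S\<close>, whose entries are then approximated one by one.\<close>

section \<open>The trace as a quadratic form\<close>

text \<open>The predictable sigma-algebra contains every subset of a null set of time times
  probability, so a predictable function need not be measurable for the plain product, while the
  goal is an iterated integral. Measurability therefore refers to the completed product
  \<open>TP\<close>, and \<open>nn_integral_TP\<close> leads back to the iterated integral. Null
  sets fit the Dynkin argument well: a null set meets every generator in a null set, so the
  generators stay closed under intersection, and its indicator is approximated by 0. Step functions
  vanish at time 0 and after their last time point; the first defect sits on a null set, the second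
  is harmless because each approximation concerns one bounded interval only. Distances are kept
  squared, with values in \<open>ennreal\<close>. The inequality (x + y)^2 \<le> 2 x^2 + 2 y^2
  replaces the triangle inequality, whence the recurring \<epsilon> / 4. One sequence must serve all
  a < t at once. The integral grows with the interval, so errors 1 / (m + 1) on intervals [0, b m]
  that eventually cover each t suffice.\<close>

definition cd_entries :: "nat \<Rightarrow> nat \<Rightarrow> nat \<Rightarrow> (nat \<times> nat \<times> nat) set" where
  "cd_entries r n h = {..<h} \<times> {..<n} \<times> {..<2^r}"

definition cd_entry :: "(nat \<Rightarrow> nat \<Rightarrow> nat \<Rightarrow> 'a) \<Rightarrow> nat \<times> nat \<times> nat \<Rightarrow> 'a" where
  "cd_entry X = (\<lambda>(l, k, c). X l k c)"

definition cd_unit_mat :: "nat \<times> nat \<times> nat \<Rightarrow> nat \<Rightarrow> nat \<Rightarrow> nat \<Rightarrow> 'a::comm_ring_1" where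
  "cd_unit_mat i = (\<lambda>l k c. if i = (l, k, c) then 1 else 0)"

definition trace_gram ::
  "nat \<Rightarrow> nat \<Rightarrow> nat \<Rightarrow> (nat \<Rightarrow> nat \<Rightarrow> nat \<Rightarrow> real) \<Rightarrow> (nat \<Rightarrow> nat \<Rightarrow> nat \<Rightarrow> real) \<Rightarrow> real" where
  "trace_gram r n h V X = (\<Sum>l<h. \<Sum>j<n. \<Sum>c<2^r. (cd_matmul r n X V l j c)\<^sup>2)"

lemma finite_cd_entries [simp]: "finite (cd_entries r n h)"
  by (simp add: cd_entries_def)

lemma cd_mats_expand:
  fixes X :: "nat \<Rightarrow> nat \<Rightarrow> nat \<Rightarrow> 'a::comm_ring_1"
  assumes "X \<in> cd_mats r n h"
  shows "X l k c = (\<Sum>i\<in>cd_entries r n h. cd_entry X i * cd_unit_mat i l k c)"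
proof -
  have "(\<Sum>i\<in>cd_entries r n h. cd_entry X i * cd_unit_mat i l k c)
      = (\<Sum>i\<in>cd_entries r n h. if i = (l, k, c) then cd_entry X (l, k, c) else 0)"
    by (rule sum.cong) (auto simp: cd_unit_mat_def)
  also have "\<dots> = (if (l, k, c) \<in> cd_entries r n h then X l k c else 0)"
    by (simp add: cd_entry_def)
  also have "\<dots> = X l k c"
    using assms by (fastforce simp: cd_entries_def cd_mats_def cd_alg_def cd_zero_def not_less)
  finally show ?thesis ..
qed

text \<open>The Cayley-Dickson product is neither associative nor, for large r, compatible with the
  norm, but it is bilinear over the scalars. Each coordinate of X V is thus a linear form in the
  finitely many entries of X; both the size and the measurability of the trace are read off from
  this.\<close>

lemma cd_matmul_expand:
  fixes X V :: "nat \<Rightarrow> nat \<Rightarrow> nat \<Rightarrow> 'a::comm_ring_1"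
  assumes "X \<in> cd_mats r n h"
  shows "cd_matmul r n X V l j c
    = (\<Sum>i\<in>cd_entries r n h. cd_entry X i * cd_matmul r n (cd_unit_mat i) V l j c)"
proof -
  have "X l k = (\<lambda>c. \<Sum>i\<in>cd_entries r n h. cd_entry X i * cd_unit_mat i l k c)" for k
    by (intro ext cd_mats_expand assms)
  then have "cd_mult r (X l k) (V k j) c
      = (\<Sum>i\<in>cd_entries r n h. cd_entry X i * cd_mult r (cd_unit_mat i l k) (V k j) c)" for k
    by (simp add: cd_mult_sum_left cd_mult_scale_left)
  then show ?thesis
    by (simp add: cd_matmul_def sum_distrib_left) (rule sum.swap)
qed

lemma trace_gram_eq:
  "cd_trace h (cd_matmul r n (cd_matmul r n X V) (cd_matmul r n (cd_adjoint V) (cd_adjoint X))) 0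
    = trace_gram r n h V X"
  by (simp add: cd_trace_gram trace_gram_def cd_scalar_def)

lemma trace_gram_nonneg: "0 \<le> trace_gram r n h V X"
  by (simp add: trace_gram_def sum_nonneg)

lemma trace_gram_zero [simp]: "trace_gram r n h V (\<lambda>l k c. 0) = 0"
  by (simp add: trace_gram_def cd_matmul_def)

lemma square_add_le:
  fixes x y :: real
  shows "(x + y)\<^sup>2 \<le> 2 * x\<^sup>2 + 2 * y\<^sup>2"
  using zero_le_power2[of "x - y"] by (simp add: power2_sum power2_diff)

text \<open>Quasi-triangle inequality for the squared norm of X V, obtained coordinate by
  coordinate; it splits the final error into a truncation part and an approximation part.\<close>

lemma trace_gram_add_le:
  "trace_gram r n h V (\<lambda>l k c. X l k c + Y l k c) \<le> 2 * trace_gram r n h V X + 2 * trace_gram r n h V Y"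
proof -
  have "cd_matmul r n (\<lambda>l k c. X l k c + Y l k c) V l j c
      = cd_matmul r n X V l j c + cd_matmul r n Y V l j c" for l j c
    by (simp add: cd_matmul_def cd_mult_add_left sum.distrib)
  then show ?thesis
    unfolding trace_gram_def sum_distrib_left sum.distrib[symmetric]
    by (simp only:) (intro sum_mono square_add_le)
qed

text \<open>Continuity of the quadratic form, by Cauchy-Schwarz in the linear expansion of X V. It
  turns mean square errors of the entries into an error of the trace.\<close>

lemma trace_gram_bound:
  "\<exists>C\<ge>0. \<forall>X\<in>cd_mats r n h. trace_gram r n h V X \<le> C * (\<Sum>i\<in>cd_entries r n h. (cd_entry X i)\<^sup>2)"
proof -
  let ?I = "cd_entries r n h"
  define C where "C = real (card ?I) * (\<Sum>i\<in>?I. trace_gram r n h V (cd_unit_mat i))"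
  have "0 \<le> C"
    by (simp add: C_def sum_nonneg trace_gram_nonneg)
  moreover have "trace_gram r n h V X \<le> C * (\<Sum>i\<in>?I. (cd_entry X i)\<^sup>2)" if X: "X \<in> cd_mats r n h" for X
  proof -
    \<comment> \<open>Cauchy-Schwarz against the constant 1: the square of a sum over
      \<open>?I\<close> is at most \<open>card ?I\<close> times the sum of squares.\<close>
    have "trace_gram r n h V X
        \<le> (\<Sum>l<h. \<Sum>j<n. \<Sum>c<2^r. (\<Sum>i\<in>?I. (cd_entry X i * cd_matmul r n (cd_unit_mat i) V l j c)\<^sup>2) * card ?I)"
      unfolding trace_gram_def cd_matmul_expand[OF X]
      by (intro sum_mono sum_squared_le_sum_of_squares)
    also have "\<dots> = (\<Sum>l<h. \<Sum>j<n. \<Sum>c<2^r. \<Sum>i\<in>?I. real (card ?I) * ((cd_entry X i)\<^sup>2 * (cd_matmul r n (cd_unit_mat i) V l j c)\<^sup>2))"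
      by (simp add: sum_distrib_left power_mult_distrib mult.commute)
    \<comment> \<open>The sum over entries moves outward past c, j and l, so that the inner sums
      assemble to the form at a matrix unit.\<close>
    also have "\<dots> = (\<Sum>l<h. \<Sum>j<n. \<Sum>i\<in>?I. \<Sum>c<2^r. real (card ?I) * ((cd_entry X i)\<^sup>2 * (cd_matmul r n (cd_unit_mat i) V l j c)\<^sup>2))"
      by (intro sum.cong refl sum.swap)
    also have "\<dots> = (\<Sum>l<h. \<Sum>i\<in>?I. \<Sum>j<n. \<Sum>c<2^r. real (card ?I) * ((cd_entry X i)\<^sup>2 * (cd_matmul r n (cd_unit_mat i) V l j c)\<^sup>2))"
      by (intro sum.cong refl sum.swap)
    also have "\<dots> = (\<Sum>i\<in>?I. \<Sum>l<h. \<Sum>j<n. \<Sum>c<2^r. real (card ?I) * ((cd_entry X i)\<^sup>2 * (cd_matmul r n (cd_unit_mat i) V l j c)\<^sup>2))"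
      by (rule sum.swap)
    also have "\<dots> = real (card ?I) * (\<Sum>i\<in>?I. (cd_entry X i)\<^sup>2 * trace_gram r n h V (cd_unit_mat i))"
      by (simp add: trace_gram_def sum_distrib_left)
    \<comment> \<open>Each coefficient is replaced by the sum of all of them; unlike a maximum, this
      also makes sense for an empty index set.\<close>
    also have "\<dots> \<le> real (card ?I) * (\<Sum>i\<in>?I. (cd_entry X i)\<^sup>2 * (\<Sum>i\<in>?I. trace_gram r n h V (cd_unit_mat i)))"
      by (intro mult_left_mono sum_mono) (auto intro!: member_le_sum trace_gram_nonneg)
    also have "\<dots> = C * (\<Sum>i\<in>?I. (cd_entry X i)\<^sup>2)"
      by (simp add: C_def sum_distrib_right[symmetric] mult_ac)
    finally show ?thesis .
  qed
  ultimately show ?thesis by blast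
qed

lemma borel_measurable_trace_gram:
  assumes X: "\<And>z. z \<in> space N \<Longrightarrow> X z \<in> cd_mats r n h"
    and meas: "\<And>i. i \<in> cd_entries r n h \<Longrightarrow> (\<lambda>z. cd_entry (X z) i) \<in> borel_measurable N"
  shows "(\<lambda>z. trace_gram r n h V (X z)) \<in> borel_measurable N"
proof -
  have "(\<lambda>z. \<Sum>l<h. \<Sum>j<n. \<Sum>c<2^r.
      (\<Sum>i\<in>cd_entries r n h. cd_entry (X z) i * cd_matmul r n (cd_unit_mat i) V l j c)\<^sup>2) \<in> borel_measurable N"
    using meas by (intro borel_measurable_sum borel_measurable_power borel_measurable_times) auto
  then show ?thesis
    by (rule measurable_cong[THEN iffD1, rotated]) (simp add: trace_gram_def cd_matmul_expand[OF X])
qed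

lemma borel_measurable_cd_entry:
  fixes X :: "'b \<Rightarrow> nat \<Rightarrow> nat \<Rightarrow> nat \<Rightarrow> real"
  assumes "X \<in> borel_measurable N"
  shows "(\<lambda>z. cd_entry (X z) i) \<in> borel_measurable N"
proof -
  obtain l k c where i: "i = (l, k, c)" by (cases i)
  have "(\<lambda>z. X z l) \<in> borel_measurable N" for l
    using assms by (rule measurable_product_then_coordinatewise)
  then have "(\<lambda>z. X z l k) \<in> borel_measurable N" for l k
    by (rule measurable_product_then_coordinatewise)
  then have "(\<lambda>z. X z l k c) \<in> borel_measurable N" for l k c
    by (rule measurable_product_then_coordinatewise)
  then show ?thesis by (simp add: i cd_entry_def)
qed


section \<open>Step functions and predictable sets\<close>

definition time_partition :: "real set \<Rightarrow> (nat \<Rightarrow> real) \<Rightarrow> nat \<Rightarrow> bool" where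
  "time_partition T \<tau> k \<longleftrightarrow> 0 < k \<and> \<tau> 0 = 0 \<and> (\<forall>i<k. \<tau> i < \<tau> (Suc i)) \<and> (\<forall>i\<le>k. \<tau> i \<in> T)"

lemma time_partition_mono:
  assumes "time_partition T \<tau> k" "i \<le> j" "j \<le> k"
  shows "\<tau> i \<le> \<tau> j"
  using assms(2,3)
proof (induction j rule: dec_induct)
  case (step m)
  then have "\<tau> m < \<tau> (Suc m)"
    using assms(1) by (simp add: time_partition_def)
  with step show ?case by simp
qed simp

lemma time_partition_indicator:
  assumes "time_partition T \<tau> k" "a \<le> b" "b \<le> k"
  shows "indicat_real {\<tau> a<..\<tau> b} t = (\<Sum>i\<in>{a..<b}. indicat_real {\<tau> i<..\<tau> (Suc i)} t)"
  using assms(2,3)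
proof (induction b rule: dec_induct)
  case (step m)
  have "\<tau> a \<le> \<tau> m" "\<tau> m \<le> \<tau> (Suc m)"
    using time_partition_mono[OF assms(1)] step by auto
  then have "indicat_real {\<tau> a<..\<tau> (Suc m)} t = indicat_real {\<tau> a<..\<tau> m} t + indicat_real {\<tau> m<..\<tau> (Suc m)} t"
    by (auto split: split_indicator)
  with step show ?case by simp
qed simp

text \<open>Sorting the points gives the partition. The extra positive point x guarantees at least
  one interval, as \<open>0 < k\<close> demands; 0 comes first because T has no negative
  points.\<close>

lemma ex_time_partition:
  assumes P: "finite P" "P \<subseteq> T" "0 \<in> P" "x \<in> P" "0 < x" and T: "T \<subseteq> {0..}"
  shows "\<exists>\<tau> k. time_partition T \<tau> k \<and> P = \<tau> ` {..k}"
proof -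
  define xs where "xs = sorted_list_of_set P"
  have xs: "set xs = P" "sorted_wrt (<) xs"
    using P(1) by (simp_all add: xs_def)
  have len: "length xs = card P"
    using P(1) by (simp add: xs_def)
  have "card {0, x} \<le> card P"
    using P by (intro card_mono) auto
  then have k: "1 < length xs"
    using P(5) by (simp add: len)
  have lt: "xs ! i < xs ! j" if "i < j" "j < length xs" for i j
    using xs(2) that by (simp add: sorted_wrt_iff_nth_less)
  have nth: "xs ! i \<in> P" if "i < length xs" for i
    using xs(1) that by auto
  have zero: "xs ! 0 = 0"
  proof -
    obtain i where i: "i < length xs" "xs ! i = 0"
      using P(3) xs(1) by (metis in_set_conv_nth)
    have "0 \<le> xs ! 0"
      using nth[OF order.strict_trans[OF zero_less_one k]] P(2) T by auto
    then show ?thesis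
      using lt[of 0 i] i by (cases "i = 0") auto
  qed
  have "time_partition T (\<lambda>i. xs ! i) (length xs - 1)"
    unfolding time_partition_def using k zero lt nth P(2) by auto
  moreover have "P = (\<lambda>i. xs ! i) ` {..length xs - 1}"
  proof -
    have "{..length xs - 1} = {..<length xs}" using k by auto
    then show ?thesis
      by (auto simp: xs(1)[symmetric] set_conv_nth)
  qed
  ultimately show ?thesis by blast
qed

section \<open>Time intervals, filtrations and the completed product measure\<close>

locale time_filtration = prob_space M for M :: "'w measure" +
  fixes T :: "real set" and F :: "real \<Rightarrow> 'w measure"
  assumes T: "(\<exists>s>0. T = {0..s}) \<or> T = {0..}"
    and subalg: "t \<in> T \<Longrightarrow> subalgebra M (F t)"
    and mono: "u \<in> T \<Longrightarrow> t \<in> T \<Longrightarrow> u \<le> t \<Longrightarrow> subalgebra (F t) (F u)"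
begin

text \<open>The completion is essential: it is the measure whose null sets belong to the predictable
  sigma-algebra.\<close>

definition TP :: "(real \<times> 'w) measure" where
  "TP = completion (restrict_space lborel T \<Otimes>\<^sub>M M)"

lemma T_borel [measurable]: "T \<in> sets borel"
  using T by auto

lemma zero_T: "0 \<in> T"
  using T by auto

lemma T_nonneg: "t \<in> T \<Longrightarrow> 0 \<le> t"
  using T by auto

lemma T_sub: "t \<in> T \<Longrightarrow> {0..t} \<subseteq> T"
  using T by auto

lemma T_pos: obtains t where "t \<in> T" "0 < t"
proof -
  from T consider s where "s > 0" "T = {0..s}" | "T = {0..}" by auto
  then show ?thesis
    by cases (auto intro: that[of "_::real"] that[of 1])
qed

lemma space_F: "t \<in> T \<Longrightarrow> space (F t) = space M"
  using subalg by (simp add: subalgebra_def)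

lemma sets_F: "t \<in> T \<Longrightarrow> A \<in> sets (F t) \<Longrightarrow> A \<in> sets M"
  using subalg by (auto simp: subalgebra_def)

lemma sets_F_mono: "u \<in> T \<Longrightarrow> t \<in> T \<Longrightarrow> u \<le> t \<Longrightarrow> A \<in> sets (F u) \<Longrightarrow> A \<in> sets (F t)"
  using mono by (auto simp: subalgebra_def)

lemma space_TP: "space TP = T \<times> space M"
  by (simp add: TP_def space_pair_measure space_restrict_space)

lemma Times_TP:
  assumes "A \<in> sets borel" "A \<subseteq> T" "B \<in> sets M"
  shows "A \<times> B \<in> sets TP"
proof -
  have "A \<in> sets (restrict_space lborel T)"
    using assms by (subst sets_restrict_space_iff) auto
  then show ?thesis
    using assms(3) by (auto simp: TP_def intro!: sets_completionI_sets)
qed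

lemma sigma_finite_restrict: "sigma_finite_measure (restrict_space lborel T)"
  by (intro sigma_finite_measure_restrict_space lborel.sigma_finite_measure_axioms) simp

lemma emeasure_TP_Times:
  assumes "A \<in> sets borel" "A \<subseteq> T" "B \<in> sets M"
  shows "emeasure TP (A \<times> B) = emeasure lborel A * emeasure M B"
proof -
  interpret R: sigma_finite_measure "restrict_space lborel T" by (rule sigma_finite_restrict)
  have A: "A \<in> sets (restrict_space lborel T)"
    using assms by (subst sets_restrict_space_iff) auto
  then have "A \<times> B \<in> sets (restrict_space lborel T \<Otimes>\<^sub>M M)"
    using assms by auto
  then show ?thesis
    using A assms by (simp add: TP_def emeasure_pair_measure_Times emeasure_restrict_space)
qed

text \<open>Tonelli for the completed product: f agrees almost everywhere with some g measurable for
  the plain product, to which the usual theorem applies. Sections of f need not be measurable, but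
  they agree almost everywhere with those of g for almost all \<omega>.\<close>

lemma nn_integral_TP:
  assumes f: "f \<in> borel_measurable TP" and t: "t \<in> T"
  shows "(\<integral>\<^sup>+\<omega>. (\<integral>\<^sup>+\<tau>\<in>{0..t}. f (\<tau>, \<omega>) \<partial>lebesgue) \<partial>M) = (\<integral>\<^sup>+z\<in>{0..t} \<times> space M. f z \<partial>TP)"
proof -
  let ?R = "restrict_space lborel T"
  interpret R: sigma_finite_measure ?R by (rule sigma_finite_restrict)
  interpret pair_sigma_finite ?R M ..
  obtain g where g [measurable]: "g \<in> borel_measurable (?R \<Otimes>\<^sub>M M)" and eq: "AE z in ?R \<Otimes>\<^sub>M M. f z = g z"
    using completion_ex_borel_measurable f unfolding TP_def by blast
  interpret Q: pair_sigma_finite M ?R ..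
  \<comment> \<open>The factors are swapped so that \<open>Q.AE_pair\<close> puts the exceptional
    set on \<omega>, the outer variable of the iterated integral.\<close>
  have "AE z in M \<Otimes>\<^sub>M ?R. f (case z of (\<omega>, \<tau>) \<Rightarrow> (\<tau>, \<omega>)) = g (case z of (\<omega>, \<tau>) \<Rightarrow> (\<tau>, \<omega>))"
    using eq by (subst (asm) distr_pair_swap) (rule AE_distrD[OF measurable_pair_swap'])
  from Q.AE_pair[OF this] have ae: "AE \<omega> in M. AE \<tau> in ?R. f (\<tau>, \<omega>) = g (\<tau>, \<omega>)"
    by simp
  have sub: "{0..t} \<subseteq> T" using T_sub[OF t] .
  \<comment> \<open>Valid for arbitrary k: passing from \<open>lebesgue\<close> to
    \<open>lborel\<close> and then to the restriction to T requires no measurability of the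
    integrand.\<close>
  have res: "(\<integral>\<^sup>+\<tau>\<in>{0..t}. k \<tau> \<partial>lebesgue) = (\<integral>\<^sup>+\<tau>. k \<tau> * indicator {0..t} \<tau> \<partial>?R)" for k :: "real \<Rightarrow> ennreal"
  proof -
    have "k \<tau> * indicator {0..t} \<tau> * indicator T \<tau> = k \<tau> * indicator {0..t} \<tau>" for \<tau>
      using sub by (auto split: split_indicator)
    then show ?thesis
      by (simp add: nn_integral_completion nn_integral_restrict_space)
  qed
  have "{0..t} \<times> space M \<in> sets (?R \<Otimes>\<^sub>M M)"
    using sub by (intro pair_measureI) (auto simp: sets_restrict_space_iff)
  note [measurable] = this
  have "(\<integral>\<^sup>+\<omega>. (\<integral>\<^sup>+\<tau>\<in>{0..t}. f (\<tau>, \<omega>) \<partial>lebesgue) \<partial>M)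
      = (\<integral>\<^sup>+\<omega>. (\<integral>\<^sup>+\<tau>. g (\<tau>, \<omega>) * indicator ({0..t} \<times> space M) (\<tau>, \<omega>) \<partial>?R) \<partial>M)"
    unfolding res
  proof (rule nn_integral_cong_AE, rule AE_mp[OF ae], rule AE_I2, rule impI)
    fix \<omega> assume "\<omega> \<in> space M" and "AE \<tau> in ?R. f (\<tau>, \<omega>) = g (\<tau>, \<omega>)"
    then show "(\<integral>\<^sup>+\<tau>. f (\<tau>, \<omega>) * indicator {0..t} \<tau> \<partial>?R)
        = (\<integral>\<^sup>+\<tau>. g (\<tau>, \<omega>) * indicator ({0..t} \<times> space M) (\<tau>, \<omega>) \<partial>?R)"
      by (intro nn_integral_cong_AE) (auto elim!: eventually_mono split: split_indicator)
  qed
  also have "\<dots> = (\<integral>\<^sup>+z\<in>{0..t} \<times> space M. g z \<partial>(?R \<Otimes>\<^sub>M M))"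
    by (rule nn_integral_snd) measurable
  also have "\<dots> = (\<integral>\<^sup>+z\<in>{0..t} \<times> space M. f z \<partial>(?R \<Otimes>\<^sub>M M))"
    using eq by (intro nn_integral_cong_AE) (auto elim!: eventually_mono)
  finally show ?thesis by (simp add: TP_def nn_integral_completion)
qed

section \<open>Real-valued step functions\<close>

definition represented :: "(nat \<Rightarrow> real) \<Rightarrow> nat \<Rightarrow> (nat \<Rightarrow> 'w \<Rightarrow> real) \<Rightarrow> (real \<times> 'w \<Rightarrow> real) \<Rightarrow> bool" where
  "represented \<tau> k R g \<longleftrightarrow> (\<forall>i<k. R i \<in> borel_measurable (F (\<tau> i))) \<and>
     (\<forall>t\<in>T. \<forall>\<omega>\<in>space M. g (t, \<omega>) = (\<Sum>i<k. indicat_real {\<tau> i<..\<tau> (Suc i)} t * R i \<omega>))"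

text \<open>Demanding a representation on every sufficiently fine partition makes sums immediate: no
  common refinement has to be constructed.\<close>

definition step_function :: "(real \<times> 'w \<Rightarrow> real) \<Rightarrow> bool" where
  "step_function g \<longleftrightarrow> (\<exists>P. finite P \<and> P \<subseteq> T \<and>
     (\<forall>\<tau> k. time_partition T \<tau> k \<and> P \<subseteq> \<tau> ` {..k} \<longrightarrow> (\<exists>R. represented \<tau> k R g)))"

lemma step_function_add:
  assumes "step_function f" "step_function g"
  shows "step_function (\<lambda>z. f z + g z)"
proof -
  obtain P where P: "finite P" "P \<subseteq> T"
    "\<forall>\<tau> k. time_partition T \<tau> k \<and> P \<subseteq> \<tau> ` {..k} \<longrightarrow> (\<exists>R. represented \<tau> k R f)"
    using assms(1) unfolding step_function_def by (elim exE conjE) (rule that)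
  obtain Q where Q: "finite Q" "Q \<subseteq> T"
    "\<forall>\<tau> k. time_partition T \<tau> k \<and> Q \<subseteq> \<tau> ` {..k} \<longrightarrow> (\<exists>R. represented \<tau> k R g)"
    using assms(2) unfolding step_function_def by (elim exE conjE) (rule that)
  have "\<exists>R. represented \<tau> k R (\<lambda>z. f z + g z)" if \<tau>: "time_partition T \<tau> k" "P \<union> Q \<subseteq> \<tau> ` {..k}" for \<tau> k
  proof -
    obtain R R' where "represented \<tau> k R f" "represented \<tau> k R' g"
      using P(3)[rule_format, of \<tau> k] Q(3)[rule_format, of \<tau> k] \<tau> by auto
    then have "represented \<tau> k (\<lambda>i \<omega>. R i \<omega> + R' i \<omega>) (\<lambda>z. f z + g z)"
      by (auto simp: represented_def sum.distrib distrib_left intro!: borel_measurable_add)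
    then show ?thesis by blast
  qed
  then show ?thesis
    unfolding step_function_def using P(1,2) Q(1,2) by (intro exI[of _ "P \<union> Q"]) auto
qed

lemma step_function_cmult:
  assumes "step_function f"
  shows "step_function (\<lambda>z. c * f z)"
proof -
  obtain P where P: "finite P" "P \<subseteq> T"
    "\<forall>\<tau> k. time_partition T \<tau> k \<and> P \<subseteq> \<tau> ` {..k} \<longrightarrow> (\<exists>R. represented \<tau> k R f)"
    using assms(1) unfolding step_function_def by (elim exE conjE) (rule that)
  have "\<exists>R. represented \<tau> k R (\<lambda>z. c * f z)" if \<tau>: "time_partition T \<tau> k" "P \<subseteq> \<tau> ` {..k}" for \<tau> k
  proof -
    obtain R where "represented \<tau> k R f"
      using P(3)[rule_format, OF conjI[OF \<tau>]] by blast
    then have "represented \<tau> k (\<lambda>i \<omega>. c * R i \<omega>) (\<lambda>z. c * f z)"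
      by (auto simp: represented_def sum_distrib_left)
    then show ?thesis by blast
  qed
  then show ?thesis
    unfolding step_function_def using P(1,2) by (intro exI[of _ P]) auto
qed

lemma step_function_zero: "step_function (\<lambda>z. 0)"
  unfolding step_function_def
  by (intro exI[of _ "{}"]) (auto simp: represented_def intro!: exI[of _ "\<lambda>i \<omega>. 0"])

text \<open>The points v and t suffice as P. On a partition through them, (v,t] is a union of
  consecutive partition intervals, and A, being known at time v, stays measurable at all their left
  end points.\<close>

lemma step_function_rectangle:
  assumes v: "v \<in> T" "t \<in> T" "v < t" and A: "A \<in> sets (F v)"
  shows "step_function (indicat_real ({v<..t} \<times> A))"
proof -
  have "\<exists>R. represented \<tau> k R (indicat_real ({v<..t} \<times> A))"
    if \<tau>: "time_partition T \<tau> k" and vt: "{v, t} \<subseteq> \<tau> ` {..k}" for \<tau> k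
  proof -
    obtain a b where ab: "a \<le> k" "b \<le> k" "v = \<tau> a" "t = \<tau> b"
      using vt by auto
    have "a \<le> b"
      using time_partition_mono[OF \<tau>, of b a] v ab by (cases "a \<le> b") auto
    have \<tau>T: "\<tau> i \<in> T" if "i \<le> k" for i
      using \<tau> that by (simp add: time_partition_def)
    define R where "R = (\<lambda>i. if i \<in> {a..<b} then indicat_real A else (\<lambda>\<omega>. 0))"
    have "R i \<in> borel_measurable (F (\<tau> i))" if "i < k" for i
    proof (cases "i \<in> {a..<b}")
      case True
      then have "\<tau> a \<le> \<tau> i"
        using time_partition_mono[OF \<tau>, of a i] that by simp
      then have "A \<in> sets (F (\<tau> i))"
        using A ab \<tau>T that by (intro sets_F_mono[of "\<tau> a" "\<tau> i"]) auto
      then show ?thesis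
        using True by (simp add: R_def)
    next
      case False
      then show ?thesis by (auto simp: R_def)
    qed
    moreover have "indicat_real ({v<..t} \<times> A) (u, \<omega>) = (\<Sum>i<k. indicat_real {\<tau> i<..\<tau> (Suc i)} u * R i \<omega>)" for u \<omega>
    proof -
      have "(\<Sum>i<k. indicat_real {\<tau> i<..\<tau> (Suc i)} u * R i \<omega>)
          = (\<Sum>i\<in>{a..<b}. indicat_real {\<tau> i<..\<tau> (Suc i)} u * indicat_real A \<omega>)"
        using ab by (intro sum.mono_neutral_cong_right) (auto simp: R_def)
      also have "\<dots> = indicat_real {v<..t} u * indicat_real A \<omega>"
        using time_partition_indicator[OF \<tau> \<open>a \<le> b\<close> \<open>b \<le> k\<close>, of u] ab by (simp add: sum_distrib_right)
      finally show ?thesis by (simp add: indicator_times)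
    qed
    ultimately show ?thesis by (auto simp: represented_def)
  qed
  then show ?thesis
    unfolding step_function_def using v by (intro exI[of _ "{v, t}"]) auto
qed

section \<open>Mean square approximation on bounded time intervals\<close>

definition sq_dist :: "real \<Rightarrow> (real \<times> 'w \<Rightarrow> real) \<Rightarrow> (real \<times> 'w \<Rightarrow> real) \<Rightarrow> ennreal" where
  "sq_dist t f g = (\<integral>\<^sup>+z\<in>{0..t} \<times> space M. ennreal ((f z - g z)\<^sup>2) \<partial>TP)"

lemma interval_TP: "t \<in> T \<Longrightarrow> {0..t} \<times> space M \<in> sets TP"
  by (intro Times_TP T_sub) auto

lemma sq_dist_triangle:
  assumes [measurable]: "f \<in> borel_measurable TP" "g \<in> borel_measurable TP" "h \<in> borel_measurable TP"
    and t: "t \<in> T"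
  shows "sq_dist t f h \<le> 2 * sq_dist t f g + 2 * sq_dist t g h"
proof -
  note [measurable] = interval_TP[OF t]
  have "ennreal ((f z - h z)\<^sup>2) \<le> 2 * ennreal ((f z - g z)\<^sup>2) + 2 * ennreal ((g z - h z)\<^sup>2)" for z
    using square_add_le[of "f z - g z" "g z - h z"]
    by (simp add: ennreal_mult'[symmetric] flip: ennreal_plus ennreal_numeral)
  then have "sq_dist t f h \<le> (\<integral>\<^sup>+z. 2 * (ennreal ((f z - g z)\<^sup>2) * indicator ({0..t} \<times> space M) z)
      + 2 * (ennreal ((g z - h z)\<^sup>2) * indicator ({0..t} \<times> space M) z) \<partial>TP)"
    unfolding sq_dist_def by (intro nn_integral_mono) (auto split: split_indicator)
  also have "\<dots> = 2 * sq_dist t f g + 2 * sq_dist t g h"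
    unfolding sq_dist_def by (subst nn_integral_add) (auto simp: nn_integral_cmult)
  finally show ?thesis .
qed

text \<open>Local closure in mean square of the step functions: g may depend on t as well as on
  \<epsilon>, which admits functions that do not vanish for large times. Measurability of g is
  carried along rather than derived from a representation.\<close>

definition step_approximable :: "(real \<times> 'w \<Rightarrow> real) \<Rightarrow> bool" where
  "step_approximable f \<longleftrightarrow> f \<in> borel_measurable TP \<and>
     (\<forall>t\<in>T. \<forall>\<epsilon>>0. \<exists>g. step_function g \<and> g \<in> borel_measurable TP \<and> sq_dist t f g \<le> ennreal \<epsilon>)"

lemma step_approximable_measurable: "step_approximable f \<Longrightarrow> f \<in> borel_measurable TP"
  by (simp add: step_approximable_def)

lemma step_approximable_step:
  "step_function f \<Longrightarrow> f \<in> borel_measurable TP \<Longrightarrow> step_approximable f"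
  unfolding step_approximable_def sq_dist_def by (auto intro!: exI[of _ f])

lemma ennreal_quarters:
  assumes "0 < \<epsilon>" "a \<le> ennreal (\<epsilon> / 4)" "b \<le> ennreal (\<epsilon> / 4)"
  shows "2 * a + 2 * b \<le> ennreal \<epsilon>"
proof -
  have "2 * a + 2 * b \<le> 2 * ennreal (\<epsilon> / 4) + 2 * ennreal (\<epsilon> / 4)"
    using assms by (intro add_mono mult_left_mono) auto
  also have "\<dots> = ennreal \<epsilon>"
    using assms(1) by (simp add: ennreal_mult'[symmetric] flip: ennreal_plus ennreal_numeral)
  finally show ?thesis .
qed

text \<open>Taking the closure a second time adds nothing. The intermediate function may again
  depend on t and \<epsilon>.\<close>

lemma step_approximable_limit:
  assumes f: "f \<in> borel_measurable TP"
    and lim: "\<And>t \<epsilon>. t \<in> T \<Longrightarrow> 0 < \<epsilon> \<Longrightarrow> \<exists>g. step_approximable g \<and> sq_dist t f g \<le> ennreal \<epsilon>"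
  shows "step_approximable f"
  unfolding step_approximable_def
proof (intro conjI ballI allI impI f)
  fix t and \<epsilon> :: real assume t: "t \<in> T" and \<epsilon>: "0 < \<epsilon>"
  obtain g where g: "step_approximable g" "sq_dist t f g \<le> ennreal (\<epsilon> / 4)"
    using lim[OF t, of "\<epsilon> / 4"] \<epsilon> by auto
  then obtain h where h: "step_function h" "h \<in> borel_measurable TP" "sq_dist t g h \<le> ennreal (\<epsilon> / 4)"
    unfolding step_approximable_def using t \<epsilon> by (meson zero_less_divide_iff zero_less_numeral)
  have "sq_dist t f h \<le> 2 * sq_dist t f g + 2 * sq_dist t g h"
    by (intro sq_dist_triangle f h t step_approximable_measurable g)
  also have "\<dots> \<le> ennreal \<epsilon>"
    using g h \<epsilon> by (intro ennreal_quarters)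
  finally show "\<exists>g. step_function g \<and> g \<in> borel_measurable TP \<and> sq_dist t f g \<le> ennreal \<epsilon>"
    using h by blast
qed

lemma step_approximable_AE_cong:
  assumes f: "f \<in> borel_measurable TP" and g: "step_approximable g" and eq: "AE z in TP. f z = g z"
  shows "step_approximable f"
proof (rule step_approximable_limit[OF f])
  fix t and \<epsilon> :: real assume "0 < \<epsilon>"
  have "sq_dist t f g = (\<integral>\<^sup>+z. 0 \<partial>TP)"
    unfolding sq_dist_def using eq by (intro nn_integral_cong_AE) (auto elim!: eventually_mono)
  then show "\<exists>g. step_approximable g \<and> sq_dist t f g \<le> ennreal \<epsilon>"
    using g by auto
qed

lemma step_approximable_cmult:
  assumes "step_approximable f"
  shows "step_approximable (\<lambda>z. c * f z)"
  unfolding step_approximable_def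
proof (intro conjI ballI allI impI)
  show "(\<lambda>z. c * f z) \<in> borel_measurable TP"
    using step_approximable_measurable[OF assms] by simp
next
  fix t and \<epsilon> :: real assume t: "t \<in> T" and \<epsilon>: "0 < \<epsilon>"
  note [measurable] = interval_TP[OF t] step_approximable_measurable[OF assms]
  \<comment> \<open>The factor is c^2, but the tolerance is divided by c^2 + 1 so that c = 0 is no
    exception.\<close>
  have pos: "0 < c\<^sup>2 + 1"
    by (simp add: add_nonneg_pos)
  then obtain g where g: "step_function g" "g \<in> borel_measurable TP" "sq_dist t f g \<le> ennreal (\<epsilon> / (c\<^sup>2 + 1))"
    using assms t \<epsilon> unfolding step_approximable_def by (meson zero_less_divide_iff)
  note [measurable] = g(2)
  have "sq_dist t (\<lambda>z. c * f z) (\<lambda>z. c * g z)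
      = (\<integral>\<^sup>+z. ennreal (c\<^sup>2) * (ennreal ((f z - g z)\<^sup>2) * indicator ({0..t} \<times> space M) z) \<partial>TP)"
    unfolding sq_dist_def right_diff_distrib[symmetric] power_mult_distrib
    by (simp add: ennreal_mult mult.assoc)
  also have "\<dots> = ennreal (c\<^sup>2) * sq_dist t f g"
    unfolding sq_dist_def by (rule nn_integral_cmult) measurable
  also have "\<dots> \<le> ennreal (c\<^sup>2) * ennreal (\<epsilon> / (c\<^sup>2 + 1))"
    using g by (intro mult_left_mono) auto
  also have "\<dots> = ennreal (c\<^sup>2 * (\<epsilon> / (c\<^sup>2 + 1)))"
    using pos \<epsilon> by (intro ennreal_mult[symmetric]) auto
  also have "\<dots> \<le> ennreal \<epsilon>"
    using pos \<epsilon> by (intro ennreal_leI) (simp add: field_simps)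
  finally have "sq_dist t (\<lambda>z. c * f z) (\<lambda>z. c * g z) \<le> ennreal \<epsilon>" .
  moreover have "step_function (\<lambda>z. c * g z)"
    by (rule step_function_cmult[OF g(1)])
  moreover have "(\<lambda>z. c * g z) \<in> borel_measurable TP"
    by measurable
  ultimately show "\<exists>g. step_function g \<and> g \<in> borel_measurable TP \<and> sq_dist t (\<lambda>z. c * f z) g \<le> ennreal \<epsilon>"
    by blast
qed

lemma step_approximable_add:
  assumes f: "step_approximable f" and g: "step_approximable g"
  shows "step_approximable (\<lambda>z. f z + g z)"
  unfolding step_approximable_def
proof (intro conjI ballI allI impI)
  note [measurable] = step_approximable_measurable[OF f] step_approximable_measurable[OF g]
  show "(\<lambda>z. f z + g z) \<in> borel_measurable TP"
    by (intro borel_measurable_add step_approximable_measurable f g)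
  fix t and \<epsilon> :: real assume t: "t \<in> T" and \<epsilon>: "0 < \<epsilon>"
  then have \<epsilon>4: "0 < \<epsilon> / 4" by simp
  obtain f' where f': "step_function f'" "f' \<in> borel_measurable TP" "sq_dist t f f' \<le> ennreal (\<epsilon> / 4)"
    using f t \<epsilon>4 unfolding step_approximable_def by meson
  obtain g' where g': "step_function g'" "g' \<in> borel_measurable TP" "sq_dist t g g' \<le> ennreal (\<epsilon> / 4)"
    using g t \<epsilon>4 unfolding step_approximable_def by meson
  note [measurable] = f'(2) g'(2)
  \<comment> \<open>Through the intermediate function f' + g only one summand changes at a time, and
    the other cancels in the difference.\<close>
  have "sq_dist t (\<lambda>z. f z + g z) (\<lambda>z. f' z + g' z)
      \<le> 2 * sq_dist t (\<lambda>z. f z + g z) (\<lambda>z. f' z + g z) + 2 * sq_dist t (\<lambda>z. f' z + g z) (\<lambda>z. f' z + g' z)"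
    by (intro sq_dist_triangle t) measurable
  also have "\<dots> = 2 * sq_dist t f f' + 2 * sq_dist t g g'"
    by (simp add: sq_dist_def)
  also have "\<dots> \<le> ennreal \<epsilon>"
    using f' g' \<epsilon> by (intro ennreal_quarters)
  finally have "sq_dist t (\<lambda>z. f z + g z) (\<lambda>z. f' z + g' z) \<le> ennreal \<epsilon>" .
  moreover have "step_function (\<lambda>z. f' z + g' z)"
    by (rule step_function_add[OF f'(1) g'(1)])
  moreover have "(\<lambda>z. f' z + g' z) \<in> borel_measurable TP"
    by measurable
  ultimately show "\<exists>h. step_function h \<and> h \<in> borel_measurable TP \<and> sq_dist t (\<lambda>z. f z + g z) h \<le> ennreal \<epsilon>"
    by blast
qed

text \<open>Dominated convergence with the constant B^2, which is integrable because [0,t] times the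
  probability space has measure t.\<close>

lemma step_approximable_bounded_limit:
  fixes B :: real
  assumes u: "\<And>i::nat. step_approximable (u i)" and f: "f \<in> borel_measurable TP"
    and bnd: "\<And>i z. z \<in> space TP \<Longrightarrow> \<bar>f z - u i z\<bar> \<le> B"
    and lim: "\<And>z. z \<in> space TP \<Longrightarrow> (\<lambda>i. u i z) \<longlonglongrightarrow> f z"
  shows "step_approximable f"
proof (rule step_approximable_limit[OF f])
  fix t and \<epsilon> :: real assume t: "t \<in> T" and \<epsilon>: "0 < \<epsilon>"
  note [measurable] = interval_TP[OF t] f step_approximable_measurable[OF u]
  let ?I = "{0..t} \<times> space M"
  have "(\<lambda>i. sq_dist t f (u i)) \<longlonglongrightarrow> (\<integral>\<^sup>+z. 0 \<partial>TP)"
    unfolding sq_dist_def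
  proof (rule nn_integral_dominated_convergence[where w = "\<lambda>z. ennreal (B\<^sup>2) * indicator ?I z"])
    show "AE z in TP. ennreal ((f z - u i z)\<^sup>2) * indicator ?I z \<le> ennreal (B\<^sup>2) * indicator ?I z" for i
    proof (rule AE_I2)
      fix z assume "z \<in> space TP"
      then have "(f z - u i z)\<^sup>2 \<le> B\<^sup>2"
        using power_mono[OF bnd[of z i], of 2] by simp
      then show "ennreal ((f z - u i z)\<^sup>2) * indicator ?I z \<le> ennreal (B\<^sup>2) * indicator ?I z"
        by (intro mult_right_mono ennreal_leI) auto
    qed
    have "emeasure TP ?I = ennreal t"
      using emeasure_TP_Times[of "{0..t}" "space M"] T_sub[OF t] T_nonneg[OF t] by (simp add: emeasure_space_1)
    then show "(\<integral>\<^sup>+z. ennreal (B\<^sup>2) * indicator ?I z \<partial>TP) < \<infinity>"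
      by (simp add: nn_integral_cmult_indicator ennreal_mult_less_top)
    show "AE z in TP. (\<lambda>i. ennreal ((f z - u i z)\<^sup>2) * indicator ?I z) \<longlonglongrightarrow> 0"
    proof (rule AE_I2)
      fix z assume "z \<in> space TP"
      then have "(\<lambda>i. (f z - u i z)\<^sup>2) \<longlonglongrightarrow> (f z - f z)\<^sup>2"
        by (intro tendsto_intros lim)
      then have "(\<lambda>i. ennreal ((f z - u i z)\<^sup>2)) \<longlonglongrightarrow> ennreal 0"
        by (intro tendsto_ennrealI) simp
      then show "(\<lambda>i. ennreal ((f z - u i z)\<^sup>2) * indicator ?I z) \<longlonglongrightarrow> 0"
        by (cases "z \<in> ?I") auto
    qed
  qed measurable
  then have "eventually (\<lambda>i. sq_dist t f (u i) < ennreal \<epsilon>) sequentially"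
    using \<epsilon> by (intro order_tendstoD(2)) auto
  then obtain i where "sq_dist t f (u i) < ennreal \<epsilon>"
    using eventually_happens'[OF sequentially_bot] by blast
  then show "\<exists>g. step_approximable g \<and> sq_dist t f g \<le> ennreal \<epsilon>"
    using u by (intro exI[of _ "u i"]) auto
qed

section \<open>Generators of the predictable sigma-algebra\<close>

abbreviation predictable_sets :: "(real \<times> 'w) measure" where
  "predictable_sets \<equiv> predictable_algebra M T F"

definition predictable_generators :: "(real \<times> 'w) set set" where
  "predictable_generators =
     {{v<..t} \<times> A |v t A. v \<in> T \<and> t \<in> T \<and> v < t \<and> A \<in> sets (F v)} \<union>
     {{0} \<times> A |A. A \<in> sets (F 0)} \<union> null_sets TP"

lemma generators_TP: "predictable_generators \<subseteq> sets TP"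
proof -
  have "{v<..t} \<subseteq> T" if "v \<in> T" "t \<in> T" for v t
    using T_sub[OF that(2)] T_nonneg[OF that(1)] by auto
  then show ?thesis
    unfolding predictable_generators_def using sets_F zero_T by (auto intro!: Times_TP)
qed

lemma predictable_algebra_eq: "predictable_sets = sigma (T \<times> space M) predictable_generators"
  by (simp add: predictable_algebra_def predictable_generators_def TP_def)

lemma space_predictable: "space predictable_sets = T \<times> space M"
  by (simp add: predictable_algebra_def space_measure_of_conv)

lemma generators_Pow: "predictable_generators \<subseteq> Pow (T \<times> space M)"
  using generators_TP sets.sets_into_space[of _ TP] space_TP by fastforce

lemma sets_predictable: "sets predictable_sets = sigma_sets (T \<times> space M) predictable_generators"
  unfolding predictable_algebra_eq using generators_Pow by (rule sets_measure_of)

lemma subalgebra_predictable: "subalgebra TP predictable_sets"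
  unfolding subalgebra_def
  using generators_TP sets.sigma_sets_subset[of predictable_generators TP]
  by (simp add: sets_predictable space_predictable space_TP)

text \<open>Two rectangles meet in a rectangle that starts at \<open>max v v'\<close>, where both A
  and A' are measurable because the filtration increases. A slice at time 0 misses every (v,t],
  since v \<ge> 0. Empty intersections count as null sets.\<close>

lemma generators_Int_stable: "Int_stable predictable_generators"
proof (rule Int_stableI)
  fix a b assume ab: "a \<in> predictable_generators" "b \<in> predictable_generators"
  have null: "a \<inter> b \<in> null_sets TP" if "a \<in> predictable_generators" "b \<in> null_sets TP" for a b
    using that generators_TP by (metis Int_commute null_set_Int1 subsetD)
  show "a \<inter> b \<in> predictable_generators"
  proof (cases "a \<in> null_sets TP \<or> b \<in> null_sets TP")
    case True
    then have "a \<inter> b \<in> null_sets TP"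
      using null ab by (metis Int_commute)
    then show ?thesis by (simp add: predictable_generators_def)
  next
    case False
    then consider
      v t A v' t' A' where "a = {v<..t} \<times> A" "b = {v'<..t'} \<times> A'" "v \<in> T" "t \<in> T" "v' \<in> T" "t' \<in> T"
        "A \<in> sets (F v)" "A' \<in> sets (F v')"
      | A A' where "a = {0} \<times> A" "b = {0} \<times> A'" "A \<in> sets (F 0)" "A' \<in> sets (F 0)"
      | "a \<inter> b = {}"
      using ab T_nonneg unfolding predictable_generators_def by fastforce
    then show ?thesis
    proof cases
      case 1
      show ?thesis
      proof (cases "max v v' < min t t'")
        case True
        have "A \<in> sets (F (max v v'))" "A' \<in> sets (F (max v v'))"
          using 1 sets_F_mono[of v "max v v'" A] sets_F_mono[of v' "max v v'" A'] by (auto simp: max_def)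
        then have "A \<inter> A' \<in> sets (F (max v v'))" by auto
        moreover have "a \<inter> b = {max v v'<..min t t'} \<times> (A \<inter> A')"
          using 1 by auto
        moreover have "max v v' \<in> T" "min t t' \<in> T"
          using 1 by (auto simp: max_def min_def)
        ultimately show ?thesis
          using True unfolding predictable_generators_def by blast
      next
        case False
        then have "a \<inter> b = {}" using 1 by auto
        then show ?thesis by (simp add: predictable_generators_def)
      qed
    next
      case 2
      then have "a \<inter> b = {0} \<times> (A \<inter> A')" "A \<inter> A' \<in> sets (F 0)" by auto
      then show ?thesis unfolding predictable_generators_def by blast
    next
      case 3
      then show ?thesis by (simp add: predictable_generators_def)
    qed
  qed
qed

lemma step_approximable_null:
  assumes "A \<in> null_sets TP"
  shows "step_approximable (indicat_real A)"
proof (rule step_approximable_AE_cong)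
  show "step_approximable (\<lambda>z. 0)"
    by (intro step_approximable_step step_function_zero) auto
  show "AE z in TP. indicat_real A z = 0"
    using AE_not_in[OF assms] by eventually_elim simp
  show "indicat_real A \<in> borel_measurable TP"
    using assms by (intro borel_measurable_indicator) auto
qed

text \<open>A single time has Lebesgue measure 0. This removes the slices at time 0, where every
  step function vanishes.\<close>

lemma null_zero_Times:
  assumes "A \<in> sets M"
  shows "{0} \<times> A \<in> null_sets TP"
  using assms zero_T Times_TP[of "{0}" A] emeasure_TP_Times[of "{0}" A] by (auto simp: null_sets_def)

lemma step_approximable_generator:
  assumes "A \<in> predictable_generators"
  shows "step_approximable (indicat_real A)"
proof -
  have A: "A \<in> sets TP" using assms generators_TP by auto
  from assms consider "A \<in> null_sets TP"
    | v t B where "A = {v<..t} \<times> B" "v \<in> T" "t \<in> T" "v < t" "B \<in> sets (F v)"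
    using null_zero_Times sets_F[OF zero_T] unfolding predictable_generators_def by auto
  then show ?thesis
  proof cases
    case 2
    then show ?thesis
      using A by (auto intro!: step_approximable_step step_function_rectangle)
  qed (rule step_approximable_null)
qed

text \<open>Needed for complements in Dynkin's theorem. The whole space is not a generator; for
  given t it agrees on [0,t] with the rectangle over (0,t'], up to the null slice at time 0.\<close>

lemma step_approximable_space: "step_approximable (indicat_real (T \<times> space M))"
proof (rule step_approximable_limit)
  show "indicat_real (T \<times> space M) \<in> borel_measurable TP"
    using sets.top[of TP] by (intro borel_measurable_indicator) (simp add: space_TP)
next
  fix t and \<epsilon> :: real assume t: "t \<in> T" and \<epsilon>: "0 < \<epsilon>"
  \<comment> \<open>Since t may be 0, it is enlarged to a positive time of T.\<close>
  obtain t' where t': "t' \<in> T" "0 < t'" "t \<le> t'"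
  proof -
    obtain x where "x \<in> T" "0 < x" by (rule T_pos)
    then show ?thesis using t that[of "max t x"] by (auto simp: max_def split: if_splits)
  qed
  have "space M \<in> sets (F 0)"
    using sets.top[of "F 0"] space_F[OF zero_T] by simp
  then have gen: "{0<..t'} \<times> space M \<in> predictable_generators"
    unfolding predictable_generators_def using t' zero_T by blast
  have "sq_dist t (indicat_real (T \<times> space M)) (indicat_real ({0<..t'} \<times> space M)) = (\<integral>\<^sup>+z. 0 \<partial>TP)"
    unfolding sq_dist_def
  proof (intro nn_integral_cong_AE)
    show "AE z in TP. ennreal ((indicat_real (T \<times> space M) z - indicat_real ({0<..t'} \<times> space M) z)\<^sup>2)
        * indicator ({0..t} \<times> space M) z = 0"
      using AE_not_in[OF null_zero_Times[OF sets.top]]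
    proof eventually_elim
      case (elim z)
      then show ?case
        using t' subsetD[OF T_sub[OF t]] by (cases z) (auto split: split_indicator)
    qed
  qed
  then show "\<exists>g. step_approximable g \<and> sq_dist t (indicat_real (T \<times> space M)) g \<le> ennreal \<epsilon>"
    using step_approximable_generator[OF gen] by auto
qed

text \<open>Dynkin's theorem: complements are differences from the whole space, finite disjoint
  unions are sums, and a countable union is a limit of these with error at most 1.\<close>

lemma step_approximable_indicator:
  assumes "A \<in> sets predictable_sets"
  shows "step_approximable (indicat_real A)"
proof -
  have sub: "B \<in> sigma_sets (T \<times> space M) predictable_generators \<Longrightarrow> B \<in> sets TP \<and> B \<subseteq> T \<times> space M" for B
    using subalgebra_predictable sets.sets_into_space[of B predictable_sets]
    by (auto simp: subalgebra_def sets_predictable space_predictable)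
  have "A \<in> sigma_sets (T \<times> space M) predictable_generators"
    using assms by (simp add: sets_predictable)
  then show ?thesis
  proof (induction rule: sigma_sets_induct_disjoint[OF generators_Int_stable generators_Pow, consumes 1, case_names basic empty compl union])
    case (basic A)
    then show ?case by (rule step_approximable_generator)
  next
    case empty
    show ?case by (intro step_approximable_null) simp
  next
    case (compl A)
    then have "A \<subseteq> T \<times> space M" using sub by auto
    then have "indicat_real (T \<times> space M - A) = (\<lambda>z. indicat_real (T \<times> space M) z + (-1) * indicat_real A z)"
      by (auto simp: fun_eq_iff split: split_indicator)
    then show ?case
      using step_approximable_add[OF step_approximable_space step_approximable_cmult[OF compl(2), of "-1"]] by simp
  next
    case (union A)
    have TP: "A i \<in> sets TP" for i using union(2) sub by auto
    have "step_approximable (indicat_real (\<Union>i<k. A i))" for k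
    proof (induction k)
      case 0
      show ?case by (rule step_approximable_null) simp
    next
      case (Suc k)
      have "A i \<inter> A k = {}" if "i < k" for i
        using union(1) that by (simp add: disjoint_family_on_def)
      then have "(\<Union>i<k. A i) \<inter> A k = {}"
        by blast
      then have "indicat_real (\<Union>i<Suc k. A i) = (\<lambda>z. indicat_real (\<Union>i<k. A i) z + indicat_real (A k) z)"
        by (auto simp: lessThan_Suc fun_eq_iff split: split_indicator)
      then show ?case using step_approximable_add[OF Suc union(3)[of k]] by simp
    qed
    then show ?case
    proof (rule step_approximable_bounded_limit[where B = 1])
      show "indicat_real (\<Union>i. A i) \<in> borel_measurable TP"
        using TP by (intro borel_measurable_indicator) auto
      show "\<bar>indicat_real (\<Union>i. A i) z - indicat_real (\<Union>i<k. A i) z\<bar> \<le> 1" for k z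
        by (auto split: split_indicator)
      show "(\<lambda>k. indicat_real (\<Union>i<k. A i) z) \<longlonglongrightarrow> indicat_real (\<Union>i. A i) z" for z
        by (rule LIMSEQ_indicator_UN)
    qed
  qed
qed

section \<open>From indicators to bounded predictable functions\<close>

lemma step_approximable_bounded_nonneg:
  fixes f :: "real \<times> 'w \<Rightarrow> real"
  assumes "f \<in> borel_measurable predictable_sets" "\<And>z. 0 \<le> f z"
    and bnd: "\<And>z. z \<in> T \<times> space M \<Longrightarrow> f z \<le> B"
  shows "step_approximable f"
proof -
  have meas: "u \<in> borel_measurable TP" if "u \<in> borel_measurable predictable_sets" for u :: "real \<times> 'w \<Rightarrow> real"
    using measurable_from_subalg[OF subalgebra_predictable that] .
  \<comment> \<open>The bound belongs to the induction formula, for every B: c * u calls the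
    hypothesis for u with B / c. Nonnegativity passes the bound of a sum to its summands and that of
    a limit to its increasing approximants.\<close>
  have "(\<forall>z\<in>T \<times> space M. f z \<le> B) \<longrightarrow> step_approximable f" for B
    using assms(1,2)
  proof (induction arbitrary: B rule: borel_measurable_induct_real)
    case (set A)
    then show ?case by (simp add: step_approximable_indicator)
  next
    case (mult u c)
    show ?case
    proof (cases "c = 0")
      case True
      then show ?thesis
        by (simp add: step_approximable_step step_function_zero)
    next
      case False
      show ?thesis
      proof
        assume "\<forall>z\<in>T \<times> space M. c * u z \<le> B"
        then have "\<forall>z\<in>T \<times> space M. u z \<le> B / c"
          using mult(1) False by (auto simp: field_simps)
        then show "step_approximable (\<lambda>z. c * u z)"
          using mult.IH by (blast intro: step_approximable_cmult)
      qed
    qed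
  next
    case (add u v)
    show ?case
    proof
      assume "\<forall>z\<in>T \<times> space M. v z + u z \<le> B"
      then have "\<forall>z\<in>T \<times> space M. u z \<le> B" "\<forall>z\<in>T \<times> space M. v z \<le> B"
        using add.hyps(2,4) by (meson add_increasing2 add_increasing order_trans le_add_same_cancel1 le_add_same_cancel2)+
      then show "step_approximable (\<lambda>z. v z + u z)"
        using add.IH by (blast intro: step_approximable_add)
    qed
  next
    case (seq U)
    show ?case
    proof
      assume B: "\<forall>z\<in>T \<times> space M. f z \<le> B"
      have le: "U i z \<le> f z" if "z \<in> T \<times> space M" for i z
        using seq.hyps(3) seq.hyps(4)[of z] that
        by (intro incseq_le) (auto simp: space_predictable mono_def le_fun_def)
      have "step_approximable (U i)" for i
        using seq.IH[of i B] B le by (meson order_trans)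
      then show "step_approximable f"
      proof (rule step_approximable_bounded_limit[where B = B])
        show "f \<in> borel_measurable TP" using meas[OF assms(1)] .
        show "\<bar>f z - U i z\<bar> \<le> B" if "z \<in> space TP" for i z
        proof -
          have "U i z \<le> f z" "0 \<le> U i z" "f z \<le> B"
            using le[of z i] B seq.hyps(2)[of i z] that by (auto simp: space_TP)
          then show ?thesis by simp
        qed
        show "(\<lambda>i. U i z) \<longlonglongrightarrow> f z" if "z \<in> space TP" for z
          using seq.hyps(4)[of z] that by (simp add: space_TP space_predictable)
      qed
    qed
  qed
  then show ?thesis using bnd by blast
qed

lemma step_approximable_bounded:
  fixes f :: "real \<times> 'w \<Rightarrow> real"
  assumes f [measurable]: "f \<in> borel_measurable predictable_sets"
    and bnd: "\<And>z. z \<in> T \<times> space M \<Longrightarrow> \<bar>f z\<bar> \<le> B"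
  shows "step_approximable f"
proof -
  have "step_approximable (\<lambda>z. max 0 (f z))"
    by (rule step_approximable_bounded_nonneg[where B = "max 0 B"]) (use bnd in fastforce)+
  moreover have "step_approximable (\<lambda>z. max 0 (- f z))"
    by (rule step_approximable_bounded_nonneg[where B = "max 0 B"]) (use bnd in fastforce)+
  ultimately have "step_approximable (\<lambda>z. max 0 (f z) + (-1) * max 0 (- f z))"
    by (intro step_approximable_add step_approximable_cmult)
  also have "(\<lambda>z. max 0 (f z) + (-1) * max 0 (- f z)) = f"
    by (auto simp: fun_eq_iff max_def)
  finally show ?thesis .
qed

end


section \<open>Approximation of operator valued functions\<close>

context time_filtration
begin

text \<open>Here the definition of \<open>step_function\<close> pays off: one partition through the
  points required by all entries represents every entry, so the coefficients combine to
  matrices.\<close>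

lemma elementary_function_entries:
  assumes step: "\<And>i. i \<in> cd_entries r n h \<Longrightarrow> step_function (g i)"
  shows "\<exists>Sp. elementary_function M T F (Li_mats r n h) Sp \<and>
    (\<forall>t\<in>T. \<forall>\<omega>\<in>space M. Sp t \<omega> \<in> Li_mats r n h \<and> (\<forall>i\<in>cd_entries r n h. cd_entry (Sp t \<omega>) i = g i (t, \<omega>)))"
proof -
  let ?I = "cd_entries r n h"
  have "\<exists>P. finite P \<and> P \<subseteq> T \<and>
      (\<forall>\<tau> k. time_partition T \<tau> k \<and> P \<subseteq> \<tau> ` {..k} \<longrightarrow> (\<exists>R. represented \<tau> k R (g i)))" if "i \<in> ?I" for i
    using step[OF that] unfolding step_function_def .
  then obtain P where P: "\<And>i. i \<in> ?I \<Longrightarrow> finite (P i)" "\<And>i. i \<in> ?I \<Longrightarrow> P i \<subseteq> T"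
    and rep: "\<And>i \<tau> k. i \<in> ?I \<Longrightarrow> time_partition T \<tau> k \<Longrightarrow> P i \<subseteq> \<tau> ` {..k} \<Longrightarrow> \<exists>R. represented \<tau> k R (g i)"
    by metis
  obtain x where x: "x \<in> T" "0 < x" by (rule T_pos)
  have "\<exists>\<tau> k. time_partition T \<tau> k \<and> (\<Union>i\<in>?I. P i) \<union> {0, x} = \<tau> ` {..k}"
  proof (rule ex_time_partition)
    show "finite ((\<Union>i\<in>?I. P i) \<union> {0, x})"
      using P(1) by (intro finite_UnI finite_UN_I) simp_all
    show "(\<Union>i\<in>?I. P i) \<union> {0, x} \<subseteq> T"
      using P(2) x zero_T by blast
    show "T \<subseteq> {0..}"
      using T_nonneg by auto
  qed (use x in simp_all)
  then obtain \<tau> k where \<tau>: "time_partition T \<tau> k" and eq: "(\<Union>i\<in>?I. P i) \<union> {0, x} = \<tau> ` {..k}"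
    by blast
  have "\<exists>R. represented \<tau> k R (g i)" if "i \<in> ?I" for i
    using that eq by (intro rep \<tau>) auto
  then obtain R where R: "\<And>i. i \<in> ?I \<Longrightarrow> represented \<tau> k (R i) (g i)"
    by metis
  \<comment> \<open>The value 0 outside the index set is what puts the coefficients into
    \<open>Li_mats r n h\<close>.\<close>
  define R' where "R' = (\<lambda>j \<omega> p q c. if (p, q, c) \<in> ?I then R (p, q, c) j \<omega> else 0)"
  define Sp where "Sp = (\<lambda>t \<omega> p q c. \<Sum>j<k. indicat_real {\<tau> j<..\<tau> (Suc j)} t * R' j \<omega> p q c)"
  have R'_mats: "R' j \<omega> \<in> Li_mats r n h" for j \<omega>
    by (auto simp: R'_def cd_mats_def cd_alg_def cd_zero_def cd_entries_def fun_eq_iff)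
  have R'_meas: "R' j \<in> borel_measurable (F (\<tau> j))" if "j < k" for j
  proof (intro measurable_coordinatewise_then_product)
    fix p q c
    show "(\<lambda>\<omega>. R' j \<omega> p q c) \<in> borel_measurable (F (\<tau> j))"
      using R[of "(p, q, c)"] that by (cases "(p, q, c) \<in> ?I") (auto simp: R'_def represented_def)
  qed
  have "elementary_function M T F (Li_mats r n h) Sp"
    unfolding elementary_function_def
    using \<tau> R'_mats R'_meas
    by (intro exI[of _ k] exI[of _ \<tau>] exI[of _ R']) (simp add: time_partition_def Sp_def)
  moreover have "Sp t \<omega> \<in> Li_mats r n h" for t \<omega>
    by (auto simp: Sp_def R'_def cd_mats_def cd_alg_def cd_zero_def cd_entries_def fun_eq_iff)
  moreover have "cd_entry (Sp t \<omega>) i = g i (t, \<omega>)" if "t \<in> T" "\<omega> \<in> space M" "i \<in> ?I" for t \<omega> i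
    using R[OF that(3)] that by (cases i) (simp add: represented_def Sp_def R'_def cd_entry_def)
  ultimately show ?thesis by blast
qed

lemma expected_trace_integral_TP:
  assumes mats: "\<And>z. z \<in> T \<times> space M \<Longrightarrow> X (fst z) (snd z) \<in> Li_mats r n h"
    and meas: "\<And>i. i \<in> cd_entries r n h \<Longrightarrow> (\<lambda>z. cd_entry (X (fst z) (snd z)) i) \<in> borel_measurable TP"
    and t: "t \<in> T"
  shows "expected_trace_integral M r n h V 0 t X
    = (\<integral>\<^sup>+z\<in>{0..t} \<times> space M. ennreal (trace_gram r n h V (X (fst z) (snd z))) \<partial>TP)"
proof -
  have "(\<lambda>z. trace_gram r n h V (X (fst z) (snd z))) \<in> borel_measurable TP"
    by (rule borel_measurable_trace_gram[OF mats meas]) (auto simp: space_TP)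
  then have "(\<lambda>z. ennreal (trace_gram r n h V (X (fst z) (snd z)))) \<in> borel_measurable TP"
    by simp
  from nn_integral_TP[OF this t] show ?thesis
    by (simp add: expected_trace_integral_def trace_gram_eq)
qed

text \<open>Since \<open>A_r\<close> has zero divisors for \<open>r \<ge> 4\<close>, integrability of \<open>S V\<close> does not imply that of
  \<open>S\<close>; therefore \<open>S\<close> is truncated before its entries are approximated separately.\<close>

lemma elementary_approximation:
  assumes S: "\<And>t \<omega>. t \<in> T \<Longrightarrow> \<omega> \<in> space M \<Longrightarrow> S t \<omega> \<in> Li_mats r n h"
    and pred: "predictable M T F S"
    and t: "t \<in> T"
    and fin: "expected_trace_integral M r n h V 0 t S < \<infinity>"
    and \<epsilon>: "0 < \<epsilon>"
  shows "\<exists>Sp. elementary_function M T F (Li_mats r n h) Sp \<and>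
    expected_trace_integral M r n h V 0 t (\<lambda>\<tau> \<omega>. cd_matdiff (S \<tau> \<omega>) (Sp \<tau> \<omega>)) \<le> ennreal \<epsilon>"
proof -
  let ?I = "cd_entries r n h" and ?K = "{0..t} \<times> space M" and ?q = "trace_gram r n h V"
  define X where "X = (\<lambda>z. S (fst z) (snd z))"
  have X_mats: "X z \<in> Li_mats r n h" if "z \<in> T \<times> space M" for z
    using that S by (auto simp: X_def)
  have X_borel: "X \<in> borel_measurable predictable_sets"
    using pred by (simp add: predictable_def X_def case_prod_beta')
  have entry [measurable]: "(\<lambda>z. cd_entry (X z) i) \<in> borel_measurable predictable_sets" for i
    by (rule borel_measurable_cd_entry[OF X_borel])
  have lift: "f \<in> borel_measurable TP" if "f \<in> borel_measurable predictable_sets" for f :: "real \<times> 'w \<Rightarrow> real"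
    using measurable_from_subalg[OF subalgebra_predictable that] .
  have entry_TP [measurable]: "(\<lambda>z. cd_entry (X z) i) \<in> borel_measurable TP" for i
    by (rule lift[OF entry])
  have K_TP [measurable]: "?K \<in> sets TP" by (rule interval_TP[OF t])
  have q_TP [measurable]: "(\<lambda>z. ?q (X z)) \<in> borel_measurable TP"
    using X_mats by (intro borel_measurable_trace_gram) (auto simp: space_TP)

  define B where "B N = {z \<in> space predictable_sets. \<forall>i\<in>?I. \<bar>cd_entry (X z) i\<bar> \<le> real N}" for N :: nat
  have B_sets: "B N \<in> sets predictable_sets" for N
    unfolding B_def by measurable
  have B_TP [measurable]: "B N \<in> sets TP" for N
    using B_sets subalgebra_predictable by (auto simp: subalgebra_def)
  \<comment> \<open>X is cut off as a whole instead of entry by entry. Hence X - XN is X off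
    \<open>B N\<close> and 0 on it, and the truncation error is dominated by the trace of X
    itself.\<close>
  define XN where "XN N z = (\<lambda>l k c. indicat_real (B N) z * X z l k c)" for N z
  have XN_mats: "XN N z \<in> Li_mats r n h" if "z \<in> T \<times> space M" for N z
    using X_mats[OF that] by (auto simp: XN_def cd_mats_def cd_alg_def cd_zero_def fun_eq_iff)
  have entry_XN: "cd_entry (XN N z) i = indicat_real (B N) z * cd_entry (X z) i" for N z i
    by (cases i) (simp add: cd_entry_def XN_def)
  have q_diff: "?q (cd_matdiff (X z) (XN N z)) = ?q (X z) * indicat_real (- B N) z" for N z
    by (cases "z \<in> B N") (simp_all add: cd_matdiff_def XN_def)
  have X_int: "(\<integral>\<^sup>+z. ennreal (?q (X z)) * indicator ?K z \<partial>TP) < \<infinity>"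
    using fin expected_trace_integral_TP[of S r n h t V, OF _ _ t] X_mats entry_TP by (simp add: X_def)
  have "(\<lambda>N. \<integral>\<^sup>+z. ennreal (?q (cd_matdiff (X z) (XN N z))) * indicator ?K z \<partial>TP) \<longlonglongrightarrow> (\<integral>\<^sup>+z. 0 \<partial>TP)"
    unfolding q_diff
  proof (rule nn_integral_dominated_convergence[OF _ _ _ _ X_int])
    show "AE z in TP. ennreal (?q (X z) * indicat_real (- B N) z) * indicator ?K z
        \<le> ennreal (?q (X z)) * indicator ?K z" for N
      by (intro AE_I2) (auto split: split_indicator)
    show "AE z in TP. (\<lambda>N. ennreal (?q (X z) * indicat_real (- B N) z) * indicator ?K z) \<longlonglongrightarrow> 0"
    proof (rule AE_I2)
      fix z assume z: "z \<in> space TP"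
      \<comment> \<open>The sum of the absolute entries bounds each of them, so z lies in
        \<open>B N\<close> for all N above m and the integrand is eventually 0.\<close>
      define m where "m = (\<Sum>i\<in>?I. \<bar>cd_entry (X z) i\<bar>)"
      have "z \<in> B N" if "nat \<lceil>m\<rceil> \<le> N" for N
      proof -
        have "\<bar>cd_entry (X z) i\<bar> \<le> m" if "i \<in> ?I" for i
          unfolding m_def by (rule member_le_sum[OF that]) auto
        moreover have "m \<le> real N"
          using that by linarith
        ultimately show ?thesis
          using z by (force simp: B_def space_TP space_predictable)
      qed
      then show "(\<lambda>N. ennreal (?q (X z) * indicat_real (- B N) z) * indicator ?K z) \<longlonglongrightarrow> 0"
        by (intro tendsto_eventually eventually_sequentiallyI[of "nat \<lceil>m\<rceil>"]) simp
    qed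
  qed measurable
  then have "eventually (\<lambda>N. (\<integral>\<^sup>+z. ennreal (?q (cd_matdiff (X z) (XN N z))) * indicator ?K z \<partial>TP) < ennreal (\<epsilon> / 4)) sequentially"
    using \<epsilon> by (intro order_tendstoD(2)) auto
  then obtain N where N: "(\<integral>\<^sup>+z. ennreal (?q (cd_matdiff (X z) (XN N z))) * indicator ?K z \<partial>TP) < ennreal (\<epsilon> / 4)"
    using eventually_happens'[OF sequentially_bot] by blast

  obtain C where C: "0 \<le> C" "\<And>Y. Y \<in> Li_mats r n h \<Longrightarrow> ?q Y \<le> C * (\<Sum>i\<in>?I. (cd_entry Y i)\<^sup>2)"
    using trace_gram_bound[of r n h V] by blast
  \<comment> \<open>Chosen so that \<open>card ?I\<close> errors of size \<delta>, each multiplied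
    by C, stay below \<epsilon> / 4; the added 1 keeps the denominator positive.\<close>
  define \<delta> where "\<delta> = \<epsilon> / 4 / (real (card ?I) * C + 1)"
  have den: "0 < real (card ?I) * C + 1"
    using C(1) by (intro add_nonneg_pos) auto
  have \<delta>: "0 < \<delta>"
    unfolding \<delta>_def using \<epsilon> den by (intro divide_pos_pos) auto
  have "step_approximable (\<lambda>z. cd_entry (XN N z) i)" if "i \<in> ?I" for i
  proof (rule step_approximable_bounded[where B = "real N"])
    show "(\<lambda>z. cd_entry (XN N z) i) \<in> borel_measurable predictable_sets"
      unfolding entry_XN using B_sets by measurable
    show "\<bar>cd_entry (XN N z) i\<bar> \<le> real N" for z
      using that by (auto simp: entry_XN B_def split: split_indicator)
  qed
  then have "\<exists>g. step_function g \<and> g \<in> borel_measurable TP \<and> sq_dist t (\<lambda>z. cd_entry (XN N z) i) g \<le> ennreal \<delta>" if "i \<in> ?I" for i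
    using that t \<delta> by (simp add: step_approximable_def)
  then obtain g where g: "\<And>i. i \<in> ?I \<Longrightarrow> step_function (g i)" "\<And>i. i \<in> ?I \<Longrightarrow> g i \<in> borel_measurable TP"
    "\<And>i. i \<in> ?I \<Longrightarrow> sq_dist t (\<lambda>z. cd_entry (XN N z) i) (g i) \<le> ennreal \<delta>"
    by metis
  obtain Sp where Sp: "elementary_function M T F (Li_mats r n h) Sp"
    and Sp_mats: "\<And>u \<omega>. u \<in> T \<Longrightarrow> \<omega> \<in> space M \<Longrightarrow> Sp u \<omega> \<in> Li_mats r n h"
    and Sp_entry: "\<And>u \<omega> i. u \<in> T \<Longrightarrow> \<omega> \<in> space M \<Longrightarrow> i \<in> ?I \<Longrightarrow> cd_entry (Sp u \<omega>) i = g i (u, \<omega>)"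
    using elementary_function_entries[of r n h g] g(1) by blast
  define Y where "Y = (\<lambda>z. Sp (fst z) (snd z))"
  have Y_mats: "Y z \<in> Li_mats r n h" if "z \<in> T \<times> space M" for z
    using that Sp_mats by (auto simp: Y_def)
  have Y_entry: "cd_entry (Y z) i = g i z" if "z \<in> T \<times> space M" "i \<in> ?I" for z i
    using Sp_entry[of "fst z" "snd z" i] that by (auto simp: Y_def)
  have Y_TP: "(\<lambda>z. cd_entry (Y z) i) \<in> borel_measurable TP" if "i \<in> ?I" for i
    by (rule measurable_cong[THEN iffD1, OF _ g(2)[OF that]]) (simp add: Y_entry that space_TP)
  have entry_diff: "cd_entry (cd_matdiff P Q) i = cd_entry P i - cd_entry Q i"
    for P Q :: "nat \<Rightarrow> nat \<Rightarrow> nat \<Rightarrow> real" and i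
    by (cases i) (simp add: cd_entry_def cd_matdiff_def)
  have diff_mats: "cd_matdiff P Q \<in> Li_mats r n h" if "P \<in> Li_mats r n h" "Q \<in> Li_mats r n h" for P Q
    using that by (auto simp: cd_mats_def cd_alg_def cd_zero_def cd_matdiff_def fun_eq_iff)
  have XN_TP: "(\<lambda>z. cd_entry (XN N z) i) \<in> borel_measurable TP" for i
    unfolding entry_XN by measurable
  have q1 [measurable]: "(\<lambda>z. ?q (cd_matdiff (X z) (XN N z))) \<in> borel_measurable TP"
    unfolding q_diff by measurable
  have q2 [measurable]: "(\<lambda>z. ?q (cd_matdiff (XN N z) (Y z))) \<in> borel_measurable TP"
    using XN_TP Y_TP
    by (intro borel_measurable_trace_gram) (auto simp: space_TP entry_diff intro!: diff_mats XN_mats Y_mats)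

  have "(\<integral>\<^sup>+z. ennreal (?q (cd_matdiff (XN N z) (Y z))) * indicator ?K z \<partial>TP)
      \<le> (\<integral>\<^sup>+z. (\<Sum>i\<in>?I. ennreal C * (ennreal ((cd_entry (XN N z) i - g i z)\<^sup>2) * indicator ?K z)) \<partial>TP)"
  proof (rule nn_integral_mono)
    fix z assume "z \<in> space TP"
    then have z: "z \<in> T \<times> space M" by (simp add: space_TP)
    have "?q (cd_matdiff (XN N z) (Y z)) \<le> C * (\<Sum>i\<in>?I. (cd_entry (XN N z) i - g i z)\<^sup>2)"
      using C(2)[OF diff_mats[OF XN_mats[OF z] Y_mats[OF z]]] by (simp add: entry_diff Y_entry[OF z])
    then have "ennreal (?q (cd_matdiff (XN N z) (Y z))) \<le> (\<Sum>i\<in>?I. ennreal C * ennreal ((cd_entry (XN N z) i - g i z)\<^sup>2))"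
      using C(1) by (simp add: sum_distrib_left ennreal_mult'[symmetric] sum_ennreal ennreal_leI)
    then show "ennreal (?q (cd_matdiff (XN N z) (Y z))) * indicator ?K z
        \<le> (\<Sum>i\<in>?I. ennreal C * (ennreal ((cd_entry (XN N z) i - g i z)\<^sup>2) * indicator ?K z))"
      by (simp split: split_indicator)
  qed
  also have "\<dots> = (\<Sum>i\<in>?I. \<integral>\<^sup>+z. ennreal C * (ennreal ((cd_entry (XN N z) i - g i z)\<^sup>2) * indicator ?K z) \<partial>TP)"
    using XN_TP g(2) by (intro nn_integral_sum) simp
  also have "\<dots> = (\<Sum>i\<in>?I. ennreal C * sq_dist t (\<lambda>z. cd_entry (XN N z) i) (g i))"
    unfolding sq_dist_def using XN_TP g(2) by (intro sum.cong refl nn_integral_cmult) simp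
  also have "\<dots> \<le> (\<Sum>i\<in>?I. ennreal C * ennreal \<delta>)"
    using g(3) by (intro sum_mono mult_left_mono) auto
  also have "\<dots> = ennreal (real (card ?I) * C * \<delta>)"
    using C(1) \<delta> by (simp add: ennreal_mult'[symmetric] sum_ennreal ennreal_of_nat_eq_real_of_nat mult.assoc)
  also have "\<dots> \<le> ennreal (\<epsilon> / 4)"
  proof (rule ennreal_leI)
    have "real (card ?I) * C * \<delta> \<le> (real (card ?I) * C + 1) * \<delta>"
      using \<delta> by (intro mult_right_mono) auto
    also have "\<dots> = \<epsilon> / 4"
    proof -
      have "c * (x / c) = x" if "0 < c" for c x :: real
        using that by simp
      from this[OF den] show ?thesis by (simp only: \<delta>_def)
    qed
    finally show "real (card ?I) * C * \<delta> \<le> \<epsilon> / 4" .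
  qed
  finally have 2: "(\<integral>\<^sup>+z. ennreal (?q (cd_matdiff (XN N z) (Y z))) * indicator ?K z \<partial>TP) \<le> ennreal (\<epsilon> / 4)" .

  have "expected_trace_integral M r n h V 0 t (\<lambda>\<tau> \<omega>. cd_matdiff (S \<tau> \<omega>) (Sp \<tau> \<omega>))
      = (\<integral>\<^sup>+z. ennreal (?q (cd_matdiff (X z) (Y z))) * indicator ?K z \<partial>TP)"
  proof (subst expected_trace_integral_TP[OF _ _ t])
    show "(\<lambda>z. cd_entry (cd_matdiff (S (fst z) (snd z)) (Sp (fst z) (snd z))) i) \<in> borel_measurable TP"
      if "i \<in> ?I" for i
      using borel_measurable_diff[OF entry_TP[of i] Y_TP[OF that]] by (simp add: entry_diff X_def Y_def)
    show "cd_matdiff (S (fst z) (snd z)) (Sp (fst z) (snd z)) \<in> Li_mats r n h" if "z \<in> T \<times> space M" for z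
      using diff_mats[OF X_mats[OF that] Y_mats[OF that]] by (simp add: X_def Y_def)
  qed (simp add: X_def Y_def)
  also have "\<dots> \<le> (\<integral>\<^sup>+z. 2 * (ennreal (?q (cd_matdiff (X z) (XN N z))) * indicator ?K z)
      + 2 * (ennreal (?q (cd_matdiff (XN N z) (Y z))) * indicator ?K z) \<partial>TP)"
  proof (rule nn_integral_mono)
    fix z
    have "(\<lambda>l k c. cd_matdiff (X z) (XN N z) l k c + cd_matdiff (XN N z) (Y z) l k c) = cd_matdiff (X z) (Y z)"
      by (simp add: cd_matdiff_def)
    then have "?q (cd_matdiff (X z) (Y z)) \<le> 2 * ?q (cd_matdiff (X z) (XN N z)) + 2 * ?q (cd_matdiff (XN N z) (Y z))"
      using trace_gram_add_le[of r n h V "cd_matdiff (X z) (XN N z)" "cd_matdiff (XN N z) (Y z)"] by simp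
    then have "ennreal (?q (cd_matdiff (X z) (Y z)))
        \<le> ennreal (2 * ?q (cd_matdiff (X z) (XN N z)) + 2 * ?q (cd_matdiff (XN N z) (Y z)))"
      by (rule ennreal_leI)
    also have "\<dots> = 2 * ennreal (?q (cd_matdiff (X z) (XN N z))) + 2 * ennreal (?q (cd_matdiff (XN N z) (Y z)))"
      by (simp add: ennreal_plus ennreal_mult' trace_gram_nonneg)
    finally show "ennreal (?q (cd_matdiff (X z) (Y z))) * indicator ?K z
        \<le> 2 * (ennreal (?q (cd_matdiff (X z) (XN N z))) * indicator ?K z)
          + 2 * (ennreal (?q (cd_matdiff (XN N z) (Y z))) * indicator ?K z)"
      by (simp split: split_indicator)
  qed
  also have "\<dots> = 2 * (\<integral>\<^sup>+z. ennreal (?q (cd_matdiff (X z) (XN N z))) * indicator ?K z \<partial>TP)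
      + 2 * (\<integral>\<^sup>+z. ennreal (?q (cd_matdiff (XN N z) (Y z))) * indicator ?K z \<partial>TP)"
    by (simp add: nn_integral_add nn_integral_cmult)
  also have "\<dots> \<le> ennreal \<epsilon>"
    using \<epsilon> less_imp_le[OF N] 2 by (rule ennreal_quarters)
  finally show ?thesis using Sp by blast
qed

end


section \<open>The normal filtration\<close>

lemma augmented_filtration_subalgebra:
  assumes "\<And>u. u \<in> T \<Longrightarrow> w u \<in> borel_measurable M"
  shows "subalgebra M (augmented_filtration M T w t)"
proof -
  let ?G = "{w u -` A \<inter> space M |u A. u \<in> T \<and> u \<le> t \<and> A \<in> sets borel} \<union> null_sets M"
  have G: "?G \<subseteq> sets M"
    using assms measurable_sets by auto
  then have "?G \<subseteq> Pow (space M)"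
    using sets.space_closed by blast
  then show ?thesis
    unfolding subalgebra_def augmented_filtration_def using sets.sigma_sets_subset[OF G] by simp
qed

text \<open>The set \<open>D t\<close> of admissible later times is never empty, because a right end
  point counts as its own successor; hence the intersection stays inside the measurable sets.
  \<open>D\<close> shrinks as t grows, so the intersections increase.\<close>

lemma normal_filtration_time_filtration:
  assumes "prob_space M" and T: "(\<exists>s>0. T = {0..s}) \<or> T = {0..}"
    and w: "\<And>u. u \<in> T \<Longrightarrow> w u \<in> borel_measurable M"
  shows "time_filtration M T (normal_filtration M T w)"
proof -
  define D where "D t = {v \<in> T. t < v \<or> v = t \<and> (\<forall>u\<in>T. u \<le> t)}" for t
  define G where "G t = (\<Inter>v\<in>D t. sets (augmented_filtration M T w v))" for t
  have D: "\<exists>v. v \<in> D t" if "t \<in> T" for t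
    using that unfolding D_def by (cases "\<forall>u\<in>T. u \<le> t") (auto simp: not_le)
  have G_sets: "G t \<subseteq> sets M" if t: "t \<in> T" for t
    using D[OF t] augmented_filtration_subalgebra[of T w M, OF w]
    unfolding G_def subalgebra_def by blast
  then have G_Pow: "G t \<subseteq> Pow (space M)" if t: "t \<in> T" for t
    using t sets.space_closed by blast
  have N: "normal_filtration M T w t = sigma (space M) (G t)" for t
    by (simp add: normal_filtration_def G_def D_def)
  have "subalgebra M (normal_filtration M T w t)" if t: "t \<in> T" for t
    unfolding subalgebra_def N using G_Pow[OF t] sets.sigma_sets_subset[OF G_sets[OF t]] by simp
  moreover have "subalgebra (normal_filtration M T w t) (normal_filtration M T w u)"
    if "u \<in> T" "t \<in> T" "u \<le> t" for u t
  proof -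
    have "D t \<subseteq> D u"
      using that unfolding D_def by force
    then have "G u \<subseteq> G t"
      unfolding G_def by blast
    then show ?thesis
      unfolding subalgebra_def N using G_Pow that by (simp add: sigma_sets_mono')
  qed
  ultimately show ?thesis
    using assms(1) T by (intro time_filtration.intro time_filtration_axioms.intro) auto
qed

text \<open>Real scalars factor out of the Cayley-Dickson product, so each coordinate of
  \<open>w t\<close> is a linear combination of coordinates of the Wiener process.\<close>

lemma U_random_function_borel:
  assumes "U_random_function M T r n U V w" "t \<in> T"
  shows "w t \<in> borel_measurable M"
proof -
  obtain \<xi> where \<xi>: "wiener_process M T n \<xi>"
    and w: "\<And>\<omega>. \<omega> \<in> space M \<Longrightarrow> w t \<omega> = cd_matvec r n V (\<lambda>k. cd_scalar (if k < n then \<xi> t \<omega> k else 0))"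
    using assms unfolding U_random_function_def by blast
  have scalar: "cd_mult r v (cd_scalar x) c = x * cd_mult r v (cd_scalar 1) c" for v x c
  proof -
    have "cd_scalar x = (\<lambda>l. x * cd_scalar 1 l)"
      by (auto simp: cd_scalar_def)
    then show ?thesis
      by (simp only: cd_mult_scale_right)
  qed
  have w_eq: "w t \<omega> l c = (\<Sum>k<n. \<xi> t \<omega> k * cd_mult r (V l k) (cd_scalar 1) c)" if "\<omega> \<in> space M" for \<omega> l c
    unfolding w[OF that] cd_matvec_def by (intro sum.cong refl, subst scalar) simp
  have "(\<lambda>\<omega>. \<xi> t \<omega> k) \<in> borel_measurable M" if "k < n" for k
    using \<xi> assms(2) that by (simp add: wiener_process_def)
  then have "(\<lambda>\<omega>. w t \<omega> l c) \<in> borel_measurable M" for l c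
    by (subst measurable_cong[OF w_eq]) auto
  then show ?thesis
    by (intro measurable_coordinatewise_then_product)
qed

section \<open>One sequence for all intervals\<close>

lemma expected_trace_integral_mono:
  assumes "a' \<le> a" "t \<le> t'"
  shows "expected_trace_integral M r n h V a t S \<le> expected_trace_integral M r n h V a' t' S"
  unfolding expected_trace_integral_def using assms
  by (intro nn_integral_mono) (auto split: split_indicator)

theorem theorem2p17:
  fixes r n h :: nat
    and M :: "'w measure"
    and T :: "real set"
    and U U_half :: "nat \<Rightarrow> nat \<Rightarrow> nat \<Rightarrow> real"
    and w :: "real \<Rightarrow> 'w \<Rightarrow> nat \<Rightarrow> nat \<Rightarrow> real"
    and S :: "real \<Rightarrow> 'w \<Rightarrow> nat \<Rightarrow> nat \<Rightarrow> nat \<Rightarrow> real"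
  assumes "2 \<le> r"
    and "prob_space M"
    and "(\<exists>s>0. T = {0..s}) \<or> T = {0..}"
    and "U \<in> Li_mats r n n"
    and "U_random_function M T r n U U_half w"
    and "\<forall>t\<in>T. \<forall>\<omega>\<in>space M. S t \<omega> \<in> Li_mats r n h"
    and "predictable M T (normal_filtration M T w) S"
    and "\<forall>a\<in>T. \<forall>t\<in>T. a < t \<longrightarrow> expected_trace_integral M r n h U_half a t S < \<infinity>"
  shows "\<exists>S\<kappa> :: nat \<Rightarrow> real \<Rightarrow> 'w \<Rightarrow> nat \<Rightarrow> nat \<Rightarrow> nat \<Rightarrow> real.
    (\<forall>\<kappa>. elementary_function M T (normal_filtration M T w) (Li_mats r n h) (S\<kappa> \<kappa>)) \<and>
    (\<forall>a\<in>T. \<forall>t\<in>T. a < t \<longrightarrow>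
      (\<lambda>\<kappa>. expected_trace_integral M r n h U_half a t (\<lambda>\<tau> \<omega>. cd_matdiff (S \<tau> \<omega>) (S\<kappa> \<kappa> \<tau> \<omega>)))
        \<longlonglongrightarrow> 0)"
proof -
  let ?F = "normal_filtration M T w"
  let ?E = "expected_trace_integral M r n h U_half"
  interpret time_filtration M T ?F
    by (rule normal_filtration_time_filtration[OF assms(2,3) U_random_function_borel[OF assms(5)]])
  \<comment> \<open>Constantly s on a bounded time interval, m + 1 on the half-line. Positivity of
    \<open>b m\<close> is needed because finiteness is assumed only for a < t.\<close>
  obtain b :: "nat \<Rightarrow> real" where b: "\<And>m. b m \<in> T" "\<And>m. 0 < b m"
    and cofinal: "\<And>t. t \<in> T \<Longrightarrow> \<forall>\<^sub>F m in sequentially. t \<le> b m"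
  proof -
    from assms(3) consider s where "0 < s" "T = {0..s}" | "T = {0..}" by auto
    then show ?thesis
    proof cases
      case 1
      then show ?thesis by (intro that[of "\<lambda>_. s"]) auto
    next
      case 2
      have "\<forall>\<^sub>F m in sequentially. t \<le> real (Suc m)" for t
        by (intro eventually_sequentiallyI[of "nat \<lceil>t\<rceil>"]) linarith
      with 2 show ?thesis by (intro that[of "\<lambda>m. real (Suc m)"]) auto
    qed
  qed
  \<comment> \<open>Diagonal choice: the interval [0, b m] and the tolerance 1 / (m + 1) are tied to
    the same m, so for fixed t the bound holds as soon as t \<le> b m.\<close>
  have "\<exists>Sp. elementary_function M T ?F (Li_mats r n h) Sp \<and>
      ?E 0 (b m) (\<lambda>\<tau> \<omega>. cd_matdiff (S \<tau> \<omega>) (Sp \<tau> \<omega>)) \<le> ennreal (inverse (real (Suc m)))" for m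
    using assms(6,7,8) b zero_T by (intro elementary_approximation) auto
  then have "\<exists>S\<kappa>. \<forall>m. elementary_function M T ?F (Li_mats r n h) (S\<kappa> m) \<and>
      ?E 0 (b m) (\<lambda>\<tau> \<omega>. cd_matdiff (S \<tau> \<omega>) (S\<kappa> m \<tau> \<omega>)) \<le> ennreal (inverse (real (Suc m)))"
    by (intro choice allI)
  then obtain S\<kappa> where S\<kappa>: "\<And>m. elementary_function M T ?F (Li_mats r n h) (S\<kappa> m)"
    "\<And>m. ?E 0 (b m) (\<lambda>\<tau> \<omega>. cd_matdiff (S \<tau> \<omega>) (S\<kappa> m \<tau> \<omega>)) \<le> ennreal (inverse (real (Suc m)))"
    by (elim exE) (rule that, auto)
  have "(\<lambda>m. ?E a t (\<lambda>\<tau> \<omega>. cd_matdiff (S \<tau> \<omega>) (S\<kappa> m \<tau> \<omega>))) \<longlonglongrightarrow> 0" if "a \<in> T" "t \<in> T" for a t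
  proof (rule tendsto_sandwich[OF _ _ tendsto_const])
    show "\<forall>\<^sub>F m in sequentially. 0 \<le> ?E a t (\<lambda>\<tau> \<omega>. cd_matdiff (S \<tau> \<omega>) (S\<kappa> m \<tau> \<omega>))"
      by (intro always_eventually allI zero_le)
    have "?E a t (\<lambda>\<tau> \<omega>. cd_matdiff (S \<tau> \<omega>) (S\<kappa> m \<tau> \<omega>)) \<le> ennreal (inverse (real (Suc m)))"
      if "t \<le> b m" for m
      using expected_trace_integral_mono[OF T_nonneg[OF \<open>a \<in> T\<close>] that] S\<kappa>(2) by (rule order_trans)
    with cofinal[OF \<open>t \<in> T\<close>]
    show "\<forall>\<^sub>F m in sequentially. ?E a t (\<lambda>\<tau> \<omega>. cd_matdiff (S \<tau> \<omega>) (S\<kappa> m \<tau> \<omega>)) \<le> ennreal (inverse (real (Suc m)))"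
      by (rule eventually_mono)
    show "(\<lambda>m. ennreal (inverse (real (Suc m)))) \<longlonglongrightarrow> 0"
      using tendsto_ennrealI[OF LIMSEQ_inverse_real_of_nat] by (simp only: ennreal_0)
  qed
  with S\<kappa>(1) show ?thesis
    by (intro exI[of _ S\<kappa>] conjI allI ballI impI)
qed

end
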